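(* Let $n\geqslant 1$ and let $t\in\mathbb{C}$ satisfy $|t|<1$ and $|1-t|<1$. Then the affine iterated function system $\{f_0,f_1\}$ on $\mathbb{C}^n$ associated to the de Casteljau subdivision algorithm with parameter $t$ for a Bézier curve of degree $n$, in either of the two representations (a) or (b) described in the context (in (a), for any admissible choice of the vector $\mathbf{p}$), has a unique attractor, and this attractor is connected.
   Context: **Bernstein polynomials and de Casteljau matrices.** $B^m_j(t)=\binom{m}{j}t^j(1-t)^{m-j}$ for $0\leqslant j\leqslant m$. The left and right de Casteljau matrices $\mathbf{L}(t),\mathbf{R}(t)$ are the $(n+1)\times(n+1)$ matrices, with indices $i,j=0,\ldots,n$, given by $$\mathbf{L}(t)_{i,j}=B^i_j(t)\ \text{ if } j\leqslant i,\quad \mathbf{L}(t)_{i,j}=0\ \text{ if } j>i;\qquad \mathbf{R}(t)_{i,j}=B^{n-i}_{j-i}(t)\ \text{ if } j\geqslant i,\quad \mathbf{R}(t)_{i,j}=0\ \text{ if } j<i.$$ **Representation (a).** Let $\mathbf{p}=(p_0,\ldots,p_n)^\top\in\mathbb{C}^{n+1}$ be a column vector whose last two entries differ, $p_{n-1}\neq p_n$ (for instance a vector of control points in the complex plane). Let $\mathbf{P}$ be the $(n+1)\times(n+1)$ matrix whose columns are, in order, $\mathbf{p}$, then the first $n-1$ columns $\mathbf{e}_0,\ldots,\mathbf{e}_{n-2}$ of the identity matrix $\mathbf{I}_{n+1}$, then $(1,\ldots,1)^\top$; it is invertible. The matrices $\mathbf{M}^{(0)}=\mathbf{P}^{-1}\mathbf{L}(t)\mathbf{P}$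 and $\mathbf{M}^{(1)}=\mathbf{P}^{-1}\mathbf{R}(t)\mathbf{P}$ have the block form $\begin{pmatrix}\mathbf{A}_k&\mathbf{0}\\ \mathbf{b}_k&1\end{pmatrix}$ with $\mathbf{A}_k$ of size $n\times n$ and $\mathbf{b}_k$ a row vector. They act on row vectors $(x,1)$ by $(x,1)\mapsto (x,1)\mathbf{M}^{(k)}$, so the associated affine maps of $\mathbb{C}^n$ (row vectors) are $f_k(x)=x\mathbf{A}_k+\mathbf{b}_k$, $k=0,1$. **Representation (b).** The matrices $$\mathbf{M}^{(0)}_{i,j}=\delta_{i,j}t^i,\qquad \mathbf{M}^{(1)}_{i,j}=\binom{n-i}{n-j}t^{j-i}(1-t)^i\qquad i,j=0,\ldots,n$$ (entries with $j<i$ being $0$) have the block form $\begin{pmatrix}1&\mathbf{b}_k\\ \mathbf{0}&\mathbf{A}_k\end{pmatrix}$ with $\mathbf{A}_k$ of size $n\times n$. They act on row vectors $(1,x)$ by $(1,x)\mapsto(1,x)\mathbf{M}^{(k)}$, so the associated affine maps of $\mathbb{C}^n$ are $f_k(x)=x\mathbf{A}_k+\mathbf{b}_k$, $k=0,1$. **Attractor.** Let $\mathcal{H}(\mathbb{C}^n)$ be the set of nonempty compact subsets of $\mathbb{C}^n$ with the Hausdorff metric, and $F(B)=f_0(B)\cup f_1(B)$ for $B\in\mathcal{H}(\mathbb{C}^n)$. An attractor of the IFS is a set $A^*\in\mathcal{H}(\mathbb{C}^n)$ such that $F(A^* )=A^*$ and $F^k(B)\to A^*$ in the Hausdorff metric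 as $k\to\infty$ for every $B\in\mathcal{H}(\mathbb{C}^n)$. *)

theory Defs
  imports
    "HOL-Analysis.Analysis"
    "Jordan_Normal_Form.Gauss_Jordan_Elimination"
    "Jordan_Normal_Form.Determinant"
begin

no_notation vec_nth (infixl \<open>$\<close> 90)
hide_const (open) Finite_Cartesian_Product.vec Determinants.det Finite_Cartesian_Product.mat
  Finite_Cartesian_Product.row Finite_Cartesian_Product.column

section \<open>The metric space \<open>\<complex>\<^sup>n\<close>\<close>

definition complex_vec_dist :: "nat \<Rightarrow> complex Matrix.vec \<Rightarrow> complex Matrix.vec \<Rightarrow> real" where
  "complex_vec_dist n x y = L2_set (\<lambda>i. cmod (x $ i - y $ i)) {..<n}"

definition complex_vec_metric :: "nat \<Rightarrow> complex Matrix.vec metric" where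
  "complex_vec_metric n = metric (carrier_vec n, complex_vec_dist n)"

lemma Metric_space_complex_vec: "Metric_space (carrier_vec n) (complex_vec_dist n)"
proof
  fix x y z :: "complex Matrix.vec"
  show "0 \<le> complex_vec_dist n x y" by (simp add: complex_vec_dist_def L2_set_nonneg)
  show "complex_vec_dist n x y = complex_vec_dist n y x"
    by (simp add: complex_vec_dist_def norm_minus_commute)
  show "complex_vec_dist n x y = 0 \<longleftrightarrow> x = y" if "x \<in> carrier_vec n" "y \<in> carrier_vec n"
    using that by (auto simp: complex_vec_dist_def L2_set_eq_0_iff intro: eq_vecI)
  have "complex_vec_dist n x z
      \<le> L2_set (\<lambda>i. cmod (x $ i - y $ i) + cmod (y $ i - z $ i)) {..<n}"
    unfolding complex_vec_dist_def
    by (rule L2_set_mono) (metis norm_triangle_ineq diff_add_cancel add_diff_eq, simp)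
  also have "\<dots> \<le> complex_vec_dist n x y + complex_vec_dist n y z"
    unfolding complex_vec_dist_def by (rule L2_set_triangle_ineq)
  finally show "complex_vec_dist n x z \<le> complex_vec_dist n x y + complex_vec_dist n y z" .
qed

lemma mspace_complex_vec_metric [simp]: "mspace (complex_vec_metric n) = carrier_vec n"
  and mdist_complex_vec_metric [simp]: "mdist (complex_vec_metric n) = complex_vec_dist n"
  by (simp_all add: complex_vec_metric_def Metric_space.mspace_metric
      Metric_space.mdist_metric Metric_space_complex_vec)

section \<open>Attractors of iterated function systems\<close>

definition nonempty_compacts :: "'a metric \<Rightarrow> 'a set set" where
  "nonempty_compacts m = {B. B \<noteq> {} \<and> compactin (mtopology_of m) B}"

text \<open>Only meaningful on nonempty bounded sets (in particular on \<^const>\<open>nonempty_compacts\<close>),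
  where all suprema and infima below are taken over nonempty bounded sets of reals.\<close>

definition hausdorff_dist :: "'a metric \<Rightarrow> 'a set \<Rightarrow> 'a set \<Rightarrow> real" where
  "hausdorff_dist m A B =
     max (SUP a\<in>A. INF b\<in>B. mdist m a b) (SUP b\<in>B. INF a\<in>A. mdist m a b)"

definition ifs_operator :: "('a \<Rightarrow> 'a) \<Rightarrow> ('a \<Rightarrow> 'a) \<Rightarrow> 'a set \<Rightarrow> 'a set" where
  "ifs_operator f0 f1 B = f0 ` B \<union> f1 ` B"

definition is_attractor :: "'a metric \<Rightarrow> ('a \<Rightarrow> 'a) \<Rightarrow> ('a \<Rightarrow> 'a) \<Rightarrow> 'a set \<Rightarrow> bool" where
  "is_attractor m f0 f1 A \<longleftrightarrow>
     A \<in> nonempty_compacts m \<and>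
     ifs_operator f0 f1 A = A \<and>
     (\<forall>B \<in> nonempty_compacts m.
        (\<lambda>k. hausdorff_dist m ((ifs_operator f0 f1 ^^ k) B) A) \<longlonglongrightarrow> 0)"

section \<open>De Casteljau matrices\<close>

definition bernstein :: "nat \<Rightarrow> nat \<Rightarrow> complex \<Rightarrow> complex" where
  "bernstein m j t = of_nat (m choose j) * t ^ j * (1 - t) ^ (m - j)"

definition casteljau_L :: "nat \<Rightarrow> complex \<Rightarrow> complex Matrix.mat" where
  "casteljau_L n t = Matrix.mat (n + 1) (n + 1) (\<lambda>(i, j). if j \<le> i then bernstein i j t else 0)"

definition casteljau_R :: "nat \<Rightarrow> complex \<Rightarrow> complex Matrix.mat" where
  "casteljau_R n t = Matrix.mat (n + 1) (n + 1)
     (\<lambda>(i, j). if i \<le> j then bernstein (n - i) (j - i) t else 0)"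

section \<open>Representation (a)\<close>

definition P_mat :: "nat \<Rightarrow> complex Matrix.vec \<Rightarrow> complex Matrix.mat" where
  "P_mat n p = Matrix.mat (n + 1) (n + 1)
     (\<lambda>(i, j). if j = 0 then p $ i else if j = n then 1 else if i = j - 1 then 1 else 0)"

definition M0_a :: "nat \<Rightarrow> complex \<Rightarrow> complex Matrix.vec \<Rightarrow> complex Matrix.mat" where
  "M0_a n t p = the (mat_inverse (P_mat n p)) * casteljau_L n t * P_mat n p"

definition M1_a :: "nat \<Rightarrow> complex \<Rightarrow> complex Matrix.vec \<Rightarrow> complex Matrix.mat" where
  "M1_a n t p = the (mat_inverse (P_mat n p)) * casteljau_R n t * P_mat n p"

text \<open>The library multiplies matrices only with column vectors, so the row vector \<open>x A\<close> is
  written as \<open>A\<^sup>T x\<close>. The map below is read off from the blocks of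
  \<open>M = (A, 0; b, 1)\<close>.\<close>

definition affine_map_a :: "nat \<Rightarrow> complex Matrix.mat \<Rightarrow> complex Matrix.vec \<Rightarrow> complex Matrix.vec" where
  "affine_map_a n M x =
     (let (A, z, b, u) = split_block M n n in transpose_mat A *\<^sub>v x + Matrix.row b 0)"

section \<open>Representation (b)\<close>

definition M0_b :: "nat \<Rightarrow> complex \<Rightarrow> complex Matrix.mat" where
  "M0_b n t = Matrix.mat (n + 1) (n + 1) (\<lambda>(i, j). if i = j then t ^ i else 0)"

definition M1_b :: "nat \<Rightarrow> complex \<Rightarrow> complex Matrix.mat" where
  "M1_b n t = Matrix.mat (n + 1) (n + 1)
     (\<lambda>(i, j). if i \<le> j then of_nat ((n - i) choose (n - j)) * t ^ (j - i) * (1 - t) ^ i else 0)"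

text \<open>Here the blocks are \<open>M = (1, b; 0, A)\<close>.\<close>

definition affine_map_b :: "nat \<Rightarrow> complex Matrix.mat \<Rightarrow> complex Matrix.vec \<Rightarrow> complex Matrix.vec" where
  "affine_map_b n M x =
     (let (u, b, z, A) = split_block M 1 1 in transpose_mat A *\<^sub>v x + Matrix.row b 0)"

section \<open>Invertibility and block forms\<close>

lemma P_mat_carrier [simp]: "P_mat n p \<in> carrier_mat (n + 1) (n + 1)"
  by (simp add: P_mat_def)

lemma P_mat_inverse:
  assumes n: "1 \<le> n" and p: "p $ (n - 1) \<noteq> p $ n"
  obtains Q where "mat_inverse (P_mat n p) = Some Q" "Q \<in> carrier_mat (n + 1) (n + 1)"
    "P_mat n p * Q = 1\<^sub>m (n + 1)" "Q * P_mat n p = 1\<^sub>m (n + 1)"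
proof -
  let ?P = "P_mat n p"
  have ker: "v = 0\<^sub>v (n + 1)" if v: "v \<in> carrier_vec (n + 1)" and eq: "?P *\<^sub>v v = 0\<^sub>v (n + 1)" for v
  proof -
    have row: "p $ i * v $ 0 + v $ n + (if i < n - 1 then v $ (i + 1) else 0) = 0" if i: "i \<le> n" for i
    proof -
      have "0 = (?P *\<^sub>v v) $ i" using eq i by simp
      also have "\<dots> = (\<Sum>j = 0..<n + 1. ?P $$ (i, j) * v $ j)"
        using i v by (simp add: P_mat_def scalar_prod_def)
      also have "\<dots> = (\<Sum>j = 0..<n + 1. (if j = 0 then p $ i * v $ 0 else 0)
            + ((if j = n then v $ n else 0) + (if j = i + 1 then (if i < n - 1 then v $ (i + 1) else 0) else 0)))"
      proof (rule sum.cong[OF refl])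
        fix j assume "j \<in> {0..<n + 1}"
        then show "?P $$ (i, j) * v $ j = (if j = 0 then p $ i * v $ 0 else 0)
            + ((if j = n then v $ n else 0) + (if j = i + 1 then (if i < n - 1 then v $ (i + 1) else 0) else 0))"
          using n i by (cases j) (auto simp: P_mat_def)
      qed
      also have "\<dots> = p $ i * v $ 0 + (v $ n + (if i < n - 1 then v $ (i + 1) else 0))"
        unfolding sum.distrib using n by (subst (1 2 3) sum.delta) auto
      finally show ?thesis by (simp add: add.assoc)
    qed
    have "p $ (n - 1) * v $ 0 + v $ n = 0" "p $ n * v $ 0 + v $ n = 0"
      using row[of "n - 1"] row[of n] n by (simp_all split: if_splits)
    moreover have "(p $ (n - 1) - p $ n) * v $ 0
        = (p $ (n - 1) * v $ 0 + v $ n) - (p $ n * v $ 0 + v $ n)"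
      by (simp add: left_diff_distrib)
    ultimately have v0: "v $ 0 = 0" and vn: "v $ n = 0" using p by auto
    have "v $ j = 0" if "j < n + 1" for j
    proof -
      consider "j = 0" | "j = n" | i where "j = i + 1" "i < n - 1"
        using \<open>j < n + 1\<close> that(3)[of "j - 1"] by linarith
      then show ?thesis
      proof cases
        case 3
        then show ?thesis using row[of i] v0 vn by simp
      qed (use v0 vn in simp_all)
    qed
    then show ?thesis using v by (intro eq_vecI) auto
  qed
  have "det ?P \<noteq> 0" using det_0_iff_vec_prod_zero_field[OF P_mat_carrier] ker by blast
  then have "?P \<in> Units (ring_mat TYPE(complex) (n + 1) ())"
    by (rule det_non_zero_imp_unit[OF P_mat_carrier])
  then obtain Q where "mat_inverse ?P = Some Q"
    using mat_inverse(1)[OF P_mat_carrier, of n p "()"] by (cases "mat_inverse ?P") auto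
  with mat_inverse(2)[OF P_mat_carrier this] show thesis by (intro that) auto
qed

lemma sum_bernstein: "(\<Sum>j\<le>m. bernstein m j t) = 1"
  using binomial_ring[of t "1 - t" m] by (simp add: bernstein_def)

lemma casteljau_L_row_sum: "i \<le> n \<Longrightarrow> (\<Sum>j = 0..<n + 1. casteljau_L n t $$ (i, j)) = 1"
proof -
  assume i: "i \<le> n"
  have "(\<Sum>j = 0..<n + 1. casteljau_L n t $$ (i, j)) = (\<Sum>j\<le>i. bernstein i j t)"
    by (rule sum.mono_neutral_cong_right) (use i in \<open>auto simp: casteljau_L_def\<close>)
  then show ?thesis by (simp add: sum_bernstein)
qed

lemma casteljau_R_row_sum: "i \<le> n \<Longrightarrow> (\<Sum>j = 0..<n + 1. casteljau_R n t $$ (i, j)) = 1"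
proof -
  assume i: "i \<le> n"
  have "(\<Sum>j = 0..<n + 1. casteljau_R n t $$ (i, j)) = (\<Sum>j = i..n. bernstein (n - i) (j - i) t)"
    by (rule sum.mono_neutral_cong_right) (use i in \<open>auto simp: casteljau_R_def\<close>)
  also have "\<dots> = (\<Sum>j\<le>n - i. bernstein (n - i) j t)"
    by (rule sum.reindex_bij_witness[of _ "\<lambda>j. j + i" "\<lambda>j. j - i"]) (use i in auto)
  finally show ?thesis by (simp add: sum_bernstein)
qed

lemma conj_P_mat_last_col:
  assumes n: "1 \<le> n" and p: "p $ (n - 1) \<noteq> p $ n"
    and C: "C \<in> carrier_mat (n + 1) (n + 1)"
    and C1: "\<And>i. i \<le> n \<Longrightarrow> (\<Sum>j = 0..<n + 1. C $$ (i, j)) = 1"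
    and i: "i \<le> n"
  shows "(the (mat_inverse (P_mat n p)) * C * P_mat n p) $$ (i, n) = (if i = n then 1 else 0)"
proof -
  obtain Q where Q: "mat_inverse (P_mat n p) = Some Q" "Q \<in> carrier_mat (n + 1) (n + 1)"
    "Q * P_mat n p = 1\<^sub>m (n + 1)" using P_mat_inverse[OF n p] by metis
  have colP: "P_mat n p $$ (k, n) = 1" if "k < n + 1" for k
    using that n by (simp add: P_mat_def)
  have CP: "(C * P_mat n p) $$ (k, n) = P_mat n p $$ (k, n)" if k: "k < n + 1" for k
  proof -
    have "(C * P_mat n p) $$ (k, n) = (\<Sum>j = 0..<n + 1. C $$ (k, j) * P_mat n p $$ (j, n))"
      using C k P_mat_carrier[of n p] by (simp add: scalar_prod_def del: P_mat_carrier)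
    also have "\<dots> = (\<Sum>j = 0..<n + 1. C $$ (k, j))"
      by (rule sum.cong) (simp_all add: colP)
    finally show ?thesis using C1[of k] k colP by simp
  qed
  have "(Q * C * P_mat n p) $$ (i, n) = (Q * (C * P_mat n p)) $$ (i, n)"
    using Q C by (simp add: assoc_mult_mat[OF Q(2) C P_mat_carrier])
  also have "\<dots> = (\<Sum>k = 0..<n + 1. Q $$ (i, k) * (C * P_mat n p) $$ (k, n))"
    using C Q i P_mat_carrier[of n p] by (simp add: scalar_prod_def del: P_mat_carrier)
  also have "\<dots> = (\<Sum>k = 0..<n + 1. Q $$ (i, k) * P_mat n p $$ (k, n))"
    by (rule sum.cong) (simp_all add: CP)
  also have "\<dots> = (Q * P_mat n p) $$ (i, n)"
    using Q(2) i P_mat_carrier[of n p] by (simp add: scalar_prod_def del: P_mat_carrier)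
  also have "\<dots> = (if i = n then 1 else 0)" unfolding Q(3) using i by simp
  finally show ?thesis using Q by simp
qed

lemma block_form_a:
  assumes "1 \<le> n" "p $ (n - 1) \<noteq> p $ n" "i \<le> n"
  shows "M0_a n t p $$ (i, n) = (if i = n then 1 else 0)"
    and "M1_a n t p $$ (i, n) = (if i = n then 1 else 0)"
proof -
  have "casteljau_L n t \<in> carrier_mat (n + 1) (n + 1)" "casteljau_R n t \<in> carrier_mat (n + 1) (n + 1)"
    by (simp_all add: casteljau_L_def casteljau_R_def)
  then show "M0_a n t p $$ (i, n) = (if i = n then 1 else 0)"
    and "M1_a n t p $$ (i, n) = (if i = n then 1 else 0)"
    unfolding M0_a_def M1_a_def
    using conj_P_mat_last_col[OF assms(1,2) _ casteljau_L_row_sum assms(3)]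
      conj_P_mat_last_col[OF assms(1,2) _ casteljau_R_row_sum assms(3)] by simp_all
qed

lemma block_form_b:
  assumes "i \<le> n"
  shows "M0_b n t $$ (i, 0) = (if i = 0 then 1 else 0)"
    and "M1_b n t $$ (i, 0) = (if i = 0 then 1 else 0)"
  using assms by (auto simp: M0_b_def M1_b_def)

end

theory Submission
  imports Defs
begin

text \<open>
  In representation (b) both matrices are upper triangular, and on differences of points
  \<open>(1, x)\<close> only the diagonal entries \<open>t\<^sup>i\<close>, \<open>(1 - t)\<^sup>i\<close> with \<open>i \<ge> 1\<close> matter up to small off-diagonal
  terms: for small \<open>\<epsilon>\<close> the norm \<open>\<Sum>\<^sub>j \<epsilon>\<^sup>j \<bar>u\<^sub>j\<bar>\<close> is contracted by both maps. Representation (a) is affinely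
  conjugate to (b): with \<open>K = (i choose j)\<close>, which expresses the scaled power basis in the Bernstein basis,
  one has \<open>L K = K M\<^sup>(\<^sup>0\<^sup>)\<close> and \<open>R K = K M\<^sup>(\<^sup>1\<^sup>)\<close>. The attractor is the closure of the orbit of a
  fixed point, and it is connected because the fixed points \<open>z\<^sub>0\<close>, \<open>z\<^sub>1\<close> of the two maps (the end
  points of the curve) satisfy \<open>f\<^sub>0 z\<^sub>1 = f\<^sub>1 z\<^sub>0\<close>, so that chains of step \<open>\<delta>\<close> in the two pieces can
  be joined and refined by the factor of contraction.
\<close>

section \<open>Contractive systems of two overlapping maps\<close>

text \<open>The maps need not shrink \<open>mdist\<close>, so contraction is asked of a comparable
  distance \<open>e\<close>; comparability transfers boundedness, continuity and limits. The points
  \<open>z0\<close>, \<open>z1\<close> play the part of the end points of the curve, and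
  \<open>overlap\<close> makes the two pieces of an invariant compact set meet.\<close>

locale contractive_ifs =
  fixes m :: "'a metric" and f0 f1 :: "'a \<Rightarrow> 'a" and e :: "'a \<Rightarrow> 'a \<Rightarrow> real"
    and C q :: real and z0 z1 :: 'a
  assumes f0_space: "x \<in> mspace m \<Longrightarrow> f0 x \<in> mspace m"
    and f1_space: "x \<in> mspace m \<Longrightarrow> f1 x \<in> mspace m"
    and complete: "mcomplete_of m"
    and mdist_le_e: "x \<in> mspace m \<Longrightarrow> y \<in> mspace m \<Longrightarrow> mdist m x y \<le> e x y"
    and e_le_mdist: "x \<in> mspace m \<Longrightarrow> y \<in> mspace m \<Longrightarrow> e x y \<le> C * mdist m x y"
    and e_triangle: "x \<in> mspace m \<Longrightarrow> y \<in> mspace m \<Longrightarrow> z \<in> mspace m \<Longrightarrow> e x z \<le> e x y + e y z"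
    and f0_contracts: "x \<in> mspace m \<Longrightarrow> y \<in> mspace m \<Longrightarrow> e (f0 x) (f0 y) \<le> q * e x y"
    and f1_contracts: "x \<in> mspace m \<Longrightarrow> y \<in> mspace m \<Longrightarrow> e (f1 x) (f1 y) \<le> q * e x y"
    and q_nonneg: "0 \<le> q" and q_less_1: "q < 1"
    and z0_space: "z0 \<in> mspace m" and z1_space: "z1 \<in> mspace m"
    and z0_fixed: "f0 z0 = z0" and z1_fixed: "f1 z1 = z1"
    and overlap: "f0 z1 = f1 z0"
begin

sublocale Metric_space "mspace m" "mdist m" by simp

section \<open>Iterates of the set operator\<close>

abbreviation F :: "'a set \<Rightarrow> 'a set" where "F \<equiv> ifs_operator f0 f1"

lemma mtopology_of_m: "mtopology_of m = mtopology"
  by (simp add: mtopology_of_def)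

lemma in_F_iff: "x \<in> F X \<longleftrightarrow> (\<exists>y\<in>X. x = f0 y \<or> x = f1 y)"
  by (auto simp: ifs_operator_def)

lemma F_subset: "X \<subseteq> mspace m \<Longrightarrow> F X \<subseteq> mspace m"
  using f0_space f1_space by (auto simp: ifs_operator_def)

lemma F_UN: "F (\<Union>k\<in>I. X k) = (\<Union>k\<in>I. F (X k))"
  by (auto simp: ifs_operator_def)

lemma F_mono: "X \<subseteq> Y \<Longrightarrow> F X \<subseteq> F Y"
  by (auto simp: ifs_operator_def)

lemma funpow_F_subset: "X \<subseteq> mspace m \<Longrightarrow> (F ^^ k) X \<subseteq> mspace m"
  by (induction k) (auto dest: F_subset)

lemma funpow_F_nonempty: "X \<noteq> {} \<Longrightarrow> (F ^^ k) X \<noteq> {}"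
  by (induction k) (auto simp: ifs_operator_def)

lemma funpow_F_fixed: "F X = X \<Longrightarrow> (F ^^ k) X = X"
  by (induction k) auto

text \<open>A point of \<open>(F ^^ k) X\<close> comes from a point of \<open>X\<close> by a word of
  \<open>k\<close> maps; the same word applied to a point of \<open>Y\<close> shrinks the starting
  distance by \<open>q\<close> at each letter.\<close>

lemma funpow_F_approx:
  assumes "X \<subseteq> mspace m" "Y \<subseteq> mspace m" "Y \<noteq> {}"
    and D: "\<And>x y. x \<in> X \<Longrightarrow> y \<in> Y \<Longrightarrow> e x y \<le> D"
    and "x \<in> (F ^^ k) X"
  shows "\<exists>y \<in> (F ^^ k) Y. e x y \<le> q ^ k * D"
  using \<open>x \<in> (F ^^ k) X\<close>
proof (induction k arbitrary: x)
  case 0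
  then show ?case using D assms(3) by force
next
  case (Suc k)
  then have "x \<in> F ((F ^^ k) X)" by simp
  then obtain f x' where f: "f = f0 \<or> f = f1" and x': "x' \<in> (F ^^ k) X" and x: "x = f x'"
    unfolding in_F_iff by metis
  then obtain y where y: "y \<in> (F ^^ k) Y" "e x' y \<le> q ^ k * D"
    using Suc.IH by blast
  have sp: "x' \<in> mspace m" "y \<in> mspace m"
    using x' y funpow_F_subset assms by blast+
  have "e x (f y) \<le> q * e x' y"
    using f x sp f0_contracts f1_contracts by auto
  also have "\<dots> \<le> q ^ Suc k * D"
    using y(2) q_nonneg by (simp add: mult_left_mono mult.assoc)
  finally show ?case
    using f y(1) by (intro bexI[of _ "f y"]) (auto simp: in_F_iff)
qed

lemma e_bounded:
  assumes "mbounded X" "mbounded Y"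
  obtains D where "\<And>x y. x \<in> X \<Longrightarrow> y \<in> Y \<Longrightarrow> e x y \<le> D" "\<And>x y. x \<in> X \<Longrightarrow> y \<in> Y \<Longrightarrow> e y x \<le> D"
proof -
  have "mbounded (X \<union> Y)" using assms by (simp add: mbounded_Un)
  then obtain B where XY: "X \<union> Y \<subseteq> mspace m"
    and B: "\<And>x y. x \<in> X \<union> Y \<Longrightarrow> y \<in> X \<union> Y \<Longrightarrow> mdist m x y \<le> B"
    unfolding mbounded_alt by blast
  have "e x y \<le> \<bar>C\<bar> * B" if "x \<in> X \<union> Y" "y \<in> X \<union> Y" for x y
  proof -
    have "e x y \<le> C * mdist m x y" using e_le_mdist that XY by blast
    also have "\<dots> \<le> \<bar>C\<bar> * B" using B[OF that] by (intro mult_mono) auto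
    finally show ?thesis .
  qed
  then show thesis using that by blast
qed

lemma e_nonneg: "x \<in> mspace m \<Longrightarrow> y \<in> mspace m \<Longrightarrow> 0 \<le> e x y"
  using mdist_le_e nonneg order_trans by blast

lemma powq_tendsto: "(\<lambda>k. q ^ k * D) \<longlonglongrightarrow> 0"
  using q_nonneg q_less_1 by (intro tendsto_mult_left_zero LIMSEQ_power_zero) auto

lemma powq_less:
  assumes "0 < \<epsilon>" obtains k where "q ^ k * D < \<epsilon>"
proof -
  have "eventually (\<lambda>k. q ^ k * D < \<epsilon>) sequentially"
    using powq_tendsto assms by (rule order_tendstoD)
  then show thesis using that by (auto simp: eventually_sequentially)
qed

section \<open>Invariant compact sets: attraction and uniqueness\<close>

text \<open>Since \<open>A\<close> is its own \<open>k\<close>-th iterate, \<open>x\<close> lies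
  within \<open>q ^ k * D\<close> of \<open>A\<close> for every \<open>k\<close>, hence in the
  closed set \<open>A\<close>. With \<open>X\<close> another invariant set this gives uniqueness;
  with \<open>X\<close> a fixed singleton it places fixed points in \<open>A\<close>.\<close>

lemma funpow_F_points_in_invariant:
  assumes A: "A \<in> nonempty_compacts m" "F A = A"
    and X: "mbounded X" and x: "\<And>k. x \<in> (F ^^ k) X"
  shows "x \<in> A"
proof -
  have cA: "compactin mtopology A" "A \<noteq> {}"
    using A by (auto simp: nonempty_compacts_def mtopology_of_m)
  then have cl: "closedin mtopology A" and bd: "mbounded A"
    by (auto simp: compactin_imp_closedin Hausdorff_space_mtopology compactin_imp_mbounded)
  have sub: "A \<subseteq> mspace m" "X \<subseteq> mspace m"
    using bd X mbounded_subset_mspace by blast+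
  have xM: "x \<in> mspace m" using x[of 0] sub by auto
  obtain D where D: "\<And>x y. x \<in> X \<Longrightarrow> y \<in> A \<Longrightarrow> e x y \<le> D"
    using e_bounded[OF X bd] by metis
  have "\<exists>y\<in>A. y \<in> mball x r" if "r > 0" for r
  proof -
    obtain k where k: "q ^ k * D < r" using powq_less \<open>r > 0\<close> by blast
    obtain y where "y \<in> A" "e x y \<le> q ^ k * D"
      using funpow_F_approx[OF sub(2,1) cA(2) D x[of k]] funpow_F_fixed[OF A(2)] by metis
    then show ?thesis using k mdist_le_e[OF xM, of y] sub xM by (force simp: in_mball)
  qed
  then have "x \<in> mtopology closure_of A"
    using xM by (auto simp: metric_closure_of)
  then show ?thesis using cl closure_of_closedin by metis
qed

text \<open>\<open>(F ^^ k) B\<close> and \<open>(F ^^ k) A = A\<close> approximate each other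
  within \<open>q ^ k * D\<close>, so the Hausdorff distance decays geometrically.\<close>

lemma attractor_if_invariant:
  assumes A: "A \<in> nonempty_compacts m" "F A = A"
  shows "is_attractor m f0 f1 A"
  unfolding is_attractor_def
proof (intro conjI A ballI)
  fix B assume B: "B \<in> nonempty_compacts m"
  have bd: "mbounded A" "mbounded B" and ne: "A \<noteq> {}" "B \<noteq> {}"
    using A B by (auto simp: nonempty_compacts_def mtopology_of_m compactin_imp_mbounded)
  have sub: "A \<subseteq> mspace m" "B \<subseteq> mspace m"
    using bd mbounded_subset_mspace by blast+
  obtain D where D: "\<And>x y. x \<in> A \<Longrightarrow> y \<in> B \<Longrightarrow> e x y \<le> D" "\<And>x y. x \<in> A \<Longrightarrow> y \<in> B \<Longrightarrow> e y x \<le> D"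
    using e_bounded[OF bd] by metis
  \<comment> \<open>One half of the Hausdorff distance. Suprema and infima of reals require explicit
    bounds; the lower bound 0 serves the final sandwich argument.\<close>
  have half: "(SUP x\<in>X. INF y\<in>Y. mdist m x y) \<in> {0..r}"
    if "X \<noteq> {}" "Y \<noteq> {}" "X \<subseteq> mspace m" "Y \<subseteq> mspace m" "\<And>x. x \<in> X \<Longrightarrow> \<exists>y\<in>Y. e x y \<le> r" for X Y r
  proof -
    have bb: "bdd_below (mdist m x ` Y)" for x by (rule bdd_belowI[of _ 0]) auto
    have le: "(INF y\<in>Y. mdist m x y) \<le> r" if "x \<in> X" for x
    proof -
      obtain y where y: "y \<in> Y" "e x y \<le> r" using \<open>x \<in> X\<close> \<open>\<And>x. x \<in> X \<Longrightarrow> \<exists>y\<in>Y. e x y \<le> r\<close> by blast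
      then have "mdist m x y \<le> r"
        using mdist_le_e[of x y] \<open>x \<in> X\<close> \<open>X \<subseteq> mspace m\<close> \<open>Y \<subseteq> mspace m\<close> by force
      then show ?thesis using cINF_lower2[OF bb y(1)] by blast
    qed
    have ge: "0 \<le> (INF y\<in>Y. mdist m x y)" for x
      using \<open>Y \<noteq> {}\<close> by (intro cINF_greatest) auto
    obtain x where x: "x \<in> X" using \<open>X \<noteq> {}\<close> by blast
    have bda: "bdd_above ((\<lambda>x. INF y\<in>Y. mdist m x y) ` X)"
      by (rule bdd_aboveI2[of _ _ r]) (rule le)
    have "0 \<le> (SUP x\<in>X. INF y\<in>Y. mdist m x y)"
      by (rule order_trans[OF ge[of x] cSUP_upper[OF x bda]])
    moreover have "(SUP x\<in>X. INF y\<in>Y. mdist m x y) \<le> r"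
      using \<open>X \<noteq> {}\<close> le by (rule cSUP_least)
    ultimately show ?thesis by simp
  qed
  \<comment> \<open>In the second half of \<open>hausdorff_dist\<close> the inner variable stands
    first in \<open>mdist\<close>; symmetry restores the order used by \<open>half\<close>.\<close>
  have swap: "(SUP y\<in>Y. INF x\<in>X. mdist m x y) = (SUP y\<in>Y. INF x\<in>X. mdist m y x)" for X Y
    by (simp only: mdist_commute)
  have bounds: "hausdorff_dist m ((F ^^ k) B) A \<in> {0..q ^ k * D}" for k
  proof -
    have "(SUP x\<in>(F ^^ k) B. INF y\<in>A. mdist m x y) \<in> {0..q ^ k * D}"
      using funpow_F_approx[OF sub(2,1) ne(1) D(2), of _ k] funpow_F_fixed[OF A(2), of k] ne sub
      by (intro half) (auto simp: funpow_F_nonempty funpow_F_subset)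
    moreover have "(SUP x\<in>A. INF y\<in>(F ^^ k) B. mdist m x y) \<in> {0..q ^ k * D}"
      using funpow_F_approx[OF sub(1,2) ne(2) D(1), of _ k] funpow_F_fixed[OF A(2), of k] ne sub
      by (intro half) (auto simp: funpow_F_nonempty funpow_F_subset)
    ultimately show ?thesis
      unfolding hausdorff_dist_def using swap[of "(F ^^ k) B" A] by auto
  qed
  show "(\<lambda>k. hausdorff_dist m ((F ^^ k) B) A) \<longlonglongrightarrow> 0"
    by (rule tendsto_sandwich[OF _ _ tendsto_const powq_tendsto[of D]]) (use bounds in auto)
qed

lemma invariant_unique:
  assumes "A \<in> nonempty_compacts m" "F A = A" "B \<in> nonempty_compacts m" "F B = B"
  shows "A = B"
proof -
  have "X \<subseteq> Y"
    if X: "X \<in> nonempty_compacts m" "F X = X" and Y: "Y \<in> nonempty_compacts m" "F Y = Y" for X Y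
  proof
    fix x assume "x \<in> X"
    then have "x \<in> (F ^^ k) X" for k by (simp only: funpow_F_fixed[OF X(2)])
    moreover have "mbounded X"
      using X(1) by (simp add: nonempty_compacts_def mtopology_of_m compactin_imp_mbounded)
    ultimately show "x \<in> Y"
      using funpow_F_points_in_invariant[OF Y] by blast
  qed
  then show ?thesis using assms by blast
qed

section \<open>Existence: the closure of the orbit of a fixed point\<close>

definition orbit :: "'a set" where "orbit = (\<Union>k. (F ^^ k) {z0})"

text \<open>Because \<open>f0\<close> fixes \<open>z0\<close>, the singleton \<open>{z0}\<close>
  lies in its own image, so omitting the zeroth iterate does not shrink the union.\<close>

lemma orbit_invariant: "F orbit = orbit"
proof -
  have "F orbit = (\<Union>k. (F ^^ Suc k) {z0})"
    by (simp add: orbit_def F_UN)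
  moreover have "z0 \<in> (F ^^ Suc 0) {z0}" using z0_fixed by (auto simp: in_F_iff)
  moreover have "(F ^^ k) {z0} \<subseteq> (\<Union>k. (F ^^ Suc k) {z0})" for k
  proof (cases k)
    case 0
    then show ?thesis using \<open>z0 \<in> (F ^^ Suc 0) {z0}\<close> by (simp only: funpow_0) blast
  next
    case (Suc j)
    then show ?thesis by blast
  qed
  ultimately show ?thesis unfolding orbit_def by blast
qed

lemma orbit_subset: "orbit \<subseteq> mspace m"
  using funpow_F_subset[of "{z0}"] z0_space by (auto simp: orbit_def)

text \<open>The radius \<open>R = e (f1 z0) z0 / (1 - q)\<close> solves
  \<open>R = q * R + e (f1 z0) z0\<close>. As \<open>f0\<close> fixes the centre \<open>z0\<close>
  and \<open>f1\<close> moves it by \<open>e (f1 z0) z0\<close>, both maps send the ball of radius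
  \<open>R\<close> about \<open>z0\<close> into itself.\<close>

lemma orbit_e_bounded:
  assumes "x \<in> orbit"
  shows "e x z0 \<le> e (f1 z0) z0 / (1 - q)"
proof -
  let ?R = "e (f1 z0) z0 / (1 - q)"
  have R: "e (f1 z0) z0 = (1 - q) * ?R" using q_less_1 by simp
  have R0: "0 \<le> ?R" using e_nonneg[of "f1 z0" z0] f1_space z0_space q_less_1 by simp
  have "\<forall>x \<in> (F ^^ k) {z0}. e x z0 \<le> ?R" for k
  proof (induction k)
    case 0
    \<comment> \<open>Contraction at the fixed point gives \<open>e z0 z0 \<le> q * e z0 z0\<close>,
      which with \<open>q < 1\<close> forces \<open>e z0 z0 \<le> 0\<close>.\<close>
    have "e (f0 z0) (f0 z0) \<le> q * e z0 z0" using f0_contracts z0_space by blast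
    then have "(1 - q) * e z0 z0 \<le> 0" using z0_fixed by (simp add: algebra_simps)
    then have "e z0 z0 \<le> 0" using q_less_1 by (simp add: mult_le_0_iff)
    then show ?case using R0 by simp
  next
    case (Suc k)
    show ?case
    proof
      fix x assume "x \<in> (F ^^ Suc k) {z0}"
      then obtain y where y: "y \<in> (F ^^ k) {z0}" and x: "x = f0 y \<or> x = f1 y"
        by (auto simp: in_F_iff)
      have yM: "y \<in> mspace m" using y funpow_F_subset[of "{z0}"] z0_space by blast
      have yR: "q * e y z0 \<le> q * ?R" using Suc y q_nonneg by (intro mult_left_mono) auto
      from x show "e x z0 \<le> ?R"
      proof
        assume "x = f0 y"
        then have "e x z0 \<le> q * e y z0" using f0_contracts[OF yM z0_space] z0_fixed by simp
        also have "\<dots> \<le> 1 * ?R"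
          using yR mult_right_mono[of q 1 ?R] R0 q_less_1 by linarith
        finally show ?thesis by simp
      next
        assume "x = f1 y"
        then have "e x z0 \<le> e (f1 y) (f1 z0) + e (f1 z0) z0"
          using e_triangle f1_space yM z0_space by blast
        also have "\<dots> \<le> q * ?R + (1 - q) * ?R"
          using f1_contracts[OF yM z0_space] yR R by linarith
        also have "\<dots> = ?R" unfolding distrib_right[symmetric] by simp
        finally show ?thesis .
      qed
    qed
  qed
  then show ?thesis using assms by (auto simp: orbit_def)
qed

text \<open>The finite set \<open>(F ^^ k) {z0}\<close> is an \<epsilon>-net for large
  \<open>k\<close>: the orbit equals its own \<open>k\<close>-th iterate and lies at bounded
  distance from \<open>z0\<close>.\<close>

lemma mtotally_bounded_orbit: "mtotally_bounded orbit"
  unfolding mtotally_bounded_def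
proof (intro allI impI)
  fix \<epsilon> :: real assume "\<epsilon> > 0"
  let ?R = "e (f1 z0) z0 / (1 - q)"
  obtain k where k: "q ^ k * ?R < \<epsilon>" using powq_less \<open>\<epsilon> > 0\<close> by blast
  let ?K = "(F ^^ k) {z0}"
  have "finite ?K" by (induction k) (auto simp: ifs_operator_def)
  moreover have K: "?K \<subseteq> orbit" by (auto simp: orbit_def)
  moreover have "orbit \<subseteq> (\<Union>x\<in>?K. mball x \<epsilon>)"
  proof
    fix x assume x: "x \<in> orbit"
    then have "\<exists>y \<in> ?K. e x y \<le> q ^ k * ?R"
      using funpow_F_approx[OF orbit_subset, of "{z0}" ?R x k] z0_space orbit_e_bounded
        funpow_F_fixed[OF orbit_invariant, of k] by auto
    then obtain y where y: "y \<in> ?K" "e x y \<le> q ^ k * ?R" by blast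
    then have "x \<in> mspace m" "y \<in> mspace m" using x K orbit_subset by blast+
    then have "x \<in> mball y \<epsilon>" using mdist_le_e[of x y] y k by (simp add: in_mball commute)
    then show "x \<in> (\<Union>x\<in>?K. mball x \<epsilon>)" using y by blast
  qed
  ultimately show "\<exists>K. finite K \<and> K \<subseteq> orbit \<and> orbit \<subseteq> (\<Union>x\<in>K. mball x \<epsilon>)" by blast
qed

text \<open>Comparison with \<open>e\<close> makes the maps Lipschitz for \<open>mdist\<close>, with
  constant \<open>q * C\<close>.\<close>

lemma continuous_map_f:
  assumes "f = f0 \<or> f = f1"
  shows "continuous_map mtopology mtopology f"
proof -
  have "mdist m (f x) (f y) \<le> (q * C) * mdist m x y" if "x \<in> mspace m" "y \<in> mspace m" for x y
  proof -
    have "mdist m (f x) (f y) \<le> e (f x) (f y)"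
      using that assms mdist_le_e f0_space f1_space by auto
    also have "\<dots> \<le> q * e x y" using that assms f0_contracts f1_contracts by auto
    also have "\<dots> \<le> q * (C * mdist m x y)"
      using e_le_mdist[OF that] q_nonneg by (rule mult_left_mono)
    finally show ?thesis by (simp add: mult.assoc)
  qed
  then have "Lipschitz_continuous_map m m f"
    using assms f0_space f1_space by (auto simp: Lipschitz_continuous_map_def)
  then show ?thesis
    using Lipschitz_continuous_imp_continuous_map mtopology_of_m by metis
qed

text \<open>Total boundedness and completeness make the closure of the orbit compact. Continuity
  gives \<open>F ?A \<subseteq> ?A\<close>; conversely \<open>F ?A\<close> is compact, hence closed,
  and contains the orbit.\<close>

lemma exists_invariant: "\<exists>A. A \<in> nonempty_compacts m \<and> F A = A"
proof (intro exI conjI)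
  let ?A = "mtopology closure_of orbit"
  have comp: "compactin mtopology ?A"
    using mtotally_bounded_eq_compact_closure_of mtotally_bounded_orbit complete
    by (auto simp: mcomplete_of_def)
  have sub: "orbit \<subseteq> ?A" using orbit_subset by (simp add: closure_of_subset)
  have "z0 \<in> orbit" unfolding orbit_def by (rule UN_I[of 0]) auto
  then show "?A \<in> nonempty_compacts m"
    using sub comp by (auto simp: nonempty_compacts_def mtopology_of_m)
  show "F ?A = ?A"
  proof
    have "f ` ?A \<subseteq> mtopology closure_of (f ` orbit)" if "f = f0 \<or> f = f1" for f
      using continuous_map_f[OF that] continuous_map_image_closure_subset by blast
    moreover have "mtopology closure_of (f ` orbit) \<subseteq> ?A" if "f = f0 \<or> f = f1" for f
      using orbit_invariant that by (intro closure_of_mono) (auto simp: ifs_operator_def)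
    ultimately show "F ?A \<subseteq> ?A"
      unfolding ifs_operator_def by blast
    have "compactin mtopology (F ?A)"
      unfolding ifs_operator_def using comp continuous_map_f image_compactin
      by (intro compactin_Un) blast+
    then have "closedin mtopology (F ?A)"
      by (simp add: compactin_imp_closedin Hausdorff_space_mtopology)
    moreover have "orbit \<subseteq> F ?A" using F_mono[OF sub] orbit_invariant by simp
    ultimately show "?A \<subseteq> F ?A" by (rule closure_of_minimal[rotated])
  qed
qed

section \<open>Connectedness by chains\<close>

text \<open>Chains of step \<open>q\<^sup>k\<^sup>+\<^sup>1 D\<close> are the images of chains of step \<open>q\<^sup>k D\<close>, concatenated at the
  common point \<open>f0 z1 = f1 z0\<close> when the end points lie in different pieces.\<close>

lemma invariant_chains:
  assumes A: "A \<subseteq> mspace m" "F A = A" and z: "z0 \<in> A" "z1 \<in> A"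
    and D: "\<And>x y. x \<in> A \<Longrightarrow> y \<in> A \<Longrightarrow> e x y \<le> D"
  shows "x \<in> A \<Longrightarrow> y \<in> A \<Longrightarrow> (x, y) \<in> {(x, y). x \<in> A \<and> y \<in> A \<and> e x y \<le> q ^ k * D}\<^sup>*"
proof (induction k arbitrary: x y)
  case 0
  then show ?case using D by auto
next
  case (Suc k)
  let ?R = "\<lambda>k. {(x, y). x \<in> A \<and> y \<in> A \<and> e x y \<le> q ^ k * D}"
  have map: "(f x, f y) \<in> (?R (Suc k))\<^sup>*" if "f = f0 \<or> f = f1" "x \<in> A" "y \<in> A" for f x y
  proof -
    have fR: "(f a, f b) \<in> ?R (Suc k)" if "(a, b) \<in> ?R k" for a b
    proof -
      have ab: "a \<in> A" "b \<in> A" "e a b \<le> q ^ k * D" using that by auto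
      have "e (f a) (f b) \<le> q * e a b"
        using \<open>f = f0 \<or> f = f1\<close> ab A(1) f0_contracts f1_contracts by blast
      also have "\<dots> \<le> q * (q ^ k * D)" using ab q_nonneg by (simp add: mult_left_mono)
      finally have "e (f a) (f b) \<le> q ^ Suc k * D" by (simp add: mult.assoc)
      moreover have "f a \<in> A" "f b \<in> A"
        using \<open>f = f0 \<or> f = f1\<close> ab A(2) by (auto simp: ifs_operator_def)
      ultimately show ?thesis by simp
    qed
    from Suc.IH[OF that(2,3)] show ?thesis
    proof induction
      case base
      then show ?case by simp
    next
      case (step b c)
      show ?case by (rule rtrancl_into_rtrancl[OF step(3) fR[OF step(2)]])
    qed
  qed
  let ?z = "f0 z1"
  \<comment> \<open>Chains to and from the common point are both built, as the step relation is not
    symmetric a priori.\<close>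
  have "(x, ?z) \<in> (?R (Suc k))\<^sup>* \<and> (?z, x) \<in> (?R (Suc k))\<^sup>*" if "x \<in> A" for x
  proof -
    obtain x' where x': "x' \<in> A" "x = f0 x' \<or> x = f1 x'"
      using \<open>x \<in> A\<close> A(2) by (auto simp: ifs_operator_def)
    from x'(2) show ?thesis
    proof
      assume "x = f0 x'"
      then show ?thesis using map[of f0] x' z by blast
    next
      assume "x = f1 x'"
      then show ?thesis unfolding overlap using map[of f1] x' z by blast
    qed
  qed
  then show ?case using Suc.prems rtrancl_trans by meson
qed

text \<open>If \<open>U\<close> and \<open>V\<close> separated \<open>A\<close>, a Lebesgue number
  of the cover \<open>{U, V}\<close> would exceed the step of some chain from a point of
  \<open>U\<close> to one of \<open>V\<close>, and such a chain cannot leave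
  \<open>U\<close>.\<close>

lemma invariant_connected:
  assumes A: "A \<in> nonempty_compacts m" "F A = A"
  shows "connectedin mtopology A"
proof -
  have cA: "compactin mtopology A" using A by (auto simp: nonempty_compacts_def mtopology_of_m)
  then have bd: "mbounded A" by (rule compactin_imp_mbounded)
  then have sub: "A \<subseteq> mspace m" by (rule mbounded_subset_mspace)
  obtain D where D: "\<And>x y. x \<in> A \<Longrightarrow> y \<in> A \<Longrightarrow> e x y \<le> D"
    using e_bounded[OF bd bd] by metis
  \<comment> \<open>Each fixed point lies in every iterate of its own singleton, hence in
    \<open>A\<close>.\<close>
  have "z0 \<in> (F ^^ k) {z0}" "z1 \<in> (F ^^ k) {z1}" for k
    using z0_fixed z1_fixed by (induction k) (force simp: in_F_iff)+
  then have z: "z0 \<in> A" "z1 \<in> A"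
    using z0_space z1_space mbounded_insert mbounded_empty
    by (blast intro: funpow_F_points_in_invariant[OF A])+
  show ?thesis
    unfolding connectedin
  proof (intro conjI notI)
    show "A \<subseteq> topspace mtopology" using sub by simp
    assume "\<exists>U V. openin mtopology U \<and> openin mtopology V \<and> A \<subseteq> U \<union> V \<and>
      U \<inter> V \<inter> A = {} \<and> U \<inter> A \<noteq> {} \<and> V \<inter> A \<noteq> {}"
    then obtain U V x y where UV: "openin mtopology U" "openin mtopology V" "A \<subseteq> U \<union> V"
      "U \<inter> V \<inter> A = {}" and x: "x \<in> U" "x \<in> A" and y: "y \<in> V" "y \<in> A"
      by blast
    obtain \<epsilon> where \<epsilon>: "\<epsilon> > 0" "\<And>x. x \<in> A \<Longrightarrow> mball x \<epsilon> \<subseteq> U \<or> mball x \<epsilon> \<subseteq> V"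
      using lebesgue_number[OF cA, of "{U, V}"] UV by simp blast
    obtain k where k: "q ^ k * D < \<epsilon>" using powq_less \<epsilon> by blast
    have "(x, y) \<in> {(x, y). x \<in> A \<and> y \<in> A \<and> e x y \<le> q ^ k * D}\<^sup>*"
      using invariant_chains[OF sub A(2) z D] x y by blast
    then have "y \<in> U \<inter> A"
    proof induction
      case base
      then show ?case using x by blast
    next
      case (step b c)
      then have bc: "b \<in> U" "b \<in> A" "c \<in> A" "e b c < \<epsilon>" using k by auto
      \<comment> \<open>The ball about \<open>b\<close> contains \<open>b\<close>, a point of
        \<open>U \<inter> A\<close>, so it is not inside \<open>V\<close>; it lies in
        \<open>U\<close> and takes \<open>c\<close> along.\<close>
      then have "c \<in> mball b \<epsilon>" "b \<in> mball b \<epsilon>"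
        using mdist_le_e[of b c] sub \<epsilon>(1) by (auto simp: in_mball subset_iff)
      then show ?case using \<epsilon>(2)[OF bc(2)] bc UV by blast
    qed
    then show False using y UV by blast
  qed
qed

theorem unique_connected_attractor:
  "(\<exists>!A. is_attractor m f0 f1 A) \<and>
   (\<forall>A. is_attractor m f0 f1 A \<longrightarrow> connectedin (mtopology_of m) A)"
proof -
  \<comment> \<open>Attraction follows from invariance here, so the attractors are exactly the
    invariant nonempty compact sets.\<close>
  have iff: "is_attractor m f0 f1 A \<longleftrightarrow> A \<in> nonempty_compacts m \<and> F A = A" for A
    using attractor_if_invariant by (auto simp: is_attractor_def)
  obtain A where A: "A \<in> nonempty_compacts m" "F A = A"
    using exists_invariant by metis
  have "\<exists>!A. A \<in> nonempty_compacts m \<and> F A = A"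
    by (rule ex1I[of _ A]) (use A invariant_unique in auto)
  then show ?thesis
    unfolding iff mtopology_of_m using invariant_connected by simp
qed

end

section \<open>A contracted norm for representation (b)\<close>

lemma cmod_coord_le_complex_vec_dist:
  "i < n \<Longrightarrow> cmod (x $ i - y $ i) \<le> complex_vec_dist n x y"
  unfolding complex_vec_dist_def by (rule member_le_L2_set) auto

lemma complex_vec_dist_le_sum:
  "complex_vec_dist n x y \<le> (\<Sum>i<n. cmod (x $ i - y $ i))"
  unfolding complex_vec_dist_def by (rule L2_set_le_sum) auto

text \<open>Coordinates of a Cauchy sequence converge in the complex plane, and finitely many
  coordinate errors control the distance to the vector of limits.\<close>

lemma mcomplete_complex_vec_metric: "mcomplete_of (complex_vec_metric n)"
proof -
  interpret Metric_space "carrier_vec n" "complex_vec_dist n" by (rule Metric_space_complex_vec)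
  have "\<exists>L. limitin mtopology \<sigma> L sequentially" if \<sigma>: "MCauchy \<sigma>" for \<sigma>
  proof
    let ?L = "Matrix.vec n (\<lambda>i. lim (\<lambda>k. \<sigma> k $ i))"
    have "Cauchy (\<lambda>k. \<sigma> k $ i)" if i: "i < n" for i
    proof (rule CauchyI)
      fix r :: real assume "r > 0"
      then obtain N where "\<And>k l. N \<le> k \<Longrightarrow> N \<le> l \<Longrightarrow> complex_vec_dist n (\<sigma> k) (\<sigma> l) < r"
        using \<sigma> unfolding MCauchy_def by metis
      then show "\<exists>N. \<forall>k\<ge>N. \<forall>l\<ge>N. cmod (\<sigma> k $ i - \<sigma> l $ i) < r"
        using cmod_coord_le_complex_vec_dist[OF i] le_less_trans by metis
    qed
    then have "(\<lambda>k. \<sigma> k $ i) \<longlonglongrightarrow> ?L $ i" if "i < n" for i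
      using that by (simp add: Cauchy_convergent_iff convergent_LIMSEQ_iff)
    then have "(\<lambda>k. cmod (\<sigma> k $ i - ?L $ i)) \<longlonglongrightarrow> 0" if "i < n" for i
      using that by (intro tendsto_norm_zero) (simp add: LIM_zero_iff)
    then have "(\<lambda>k. \<Sum>i<n. cmod (\<sigma> k $ i - ?L $ i)) \<longlonglongrightarrow> 0"
      by (intro tendsto_null_sum) auto
    then have "(\<lambda>k. complex_vec_dist n (\<sigma> k) ?L) \<longlonglongrightarrow> 0"
      by (rule tendsto_sandwich[OF _ _ tendsto_const, rotated 2])
        (intro always_eventually allI complex_vec_dist_le_sum Metric_space.nonneg[OF Metric_space_complex_vec])+
    then show "limitin mtopology \<sigma> ?L sequentially"
      using \<sigma> by (auto simp: limitin_metric_dist_null MCauchy_def intro!: always_eventually)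
  qed
  then show ?thesis
    by (simp add: mcomplete_of_def mcomplete_def)
qed

section \<open>Row-sum bounds in weighted l1 norms\<close>

lemma index_transpose_mult_mat_vec:
  assumes "M \<in> carrier_mat N N" "u \<in> carrier_vec N" "j < N"
  shows "(transpose_mat M *\<^sub>v u) $ j = (\<Sum>i<N. M $$ (i, j) * u $ i)"
  using assms by (simp add: scalar_prod_def atLeast0LessThan)

text \<open>Exchanging the two sums turns weighted row sums into an operator bound for the action on
  row vectors. Rows at which \<open>u\<close> and \<open>v\<close> agree contribute nothing; this
  exempts row 0 for points of the hyperplane \<open>u $ 0 = 1\<close>, where the diagonal entry 1 of
  \<open>M0_b\<close> and \<open>M1_b\<close> rules out contraction.\<close>

lemma weighted_l1_transpose_le:
  fixes M :: "complex Matrix.mat"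
  assumes M: "M \<in> carrier_mat N N" and u: "u \<in> carrier_vec N" and v: "v \<in> carrier_vec N"
    and w: "\<And>j. 0 \<le> w j"
    and rows: "\<And>i. i < N \<Longrightarrow> u $ i = v $ i \<or> (\<Sum>j<N. w j * cmod (M $$ (i, j))) \<le> q * w i"
  shows "(\<Sum>j<N. w j * cmod ((transpose_mat M *\<^sub>v u) $ j - (transpose_mat M *\<^sub>v v) $ j))
    \<le> q * (\<Sum>i<N. w i * cmod (u $ i - v $ i))"
proof -
  have "w j * cmod ((transpose_mat M *\<^sub>v u) $ j - (transpose_mat M *\<^sub>v v) $ j)
      \<le> (\<Sum>i<N. w j * cmod (M $$ (i, j)) * cmod (u $ i - v $ i))" if j: "j < N" for j
  proof -
    have "(transpose_mat M *\<^sub>v u) $ j - (transpose_mat M *\<^sub>v v) $ j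
        = (\<Sum>i<N. M $$ (i, j) * (u $ i - v $ i))"
      by (simp only: index_transpose_mult_mat_vec[OF M u j] index_transpose_mult_mat_vec[OF M v j]
          sum_subtractf right_diff_distrib)
    then have "cmod ((transpose_mat M *\<^sub>v u) $ j - (transpose_mat M *\<^sub>v v) $ j)
        \<le> (\<Sum>i<N. cmod (M $$ (i, j)) * cmod (u $ i - v $ i))"
      using norm_sum[of "\<lambda>i. M $$ (i, j) * (u $ i - v $ i)" "{..<N}"] by (simp add: norm_mult)
    from mult_left_mono[OF this w[of j]] show ?thesis
      by (simp add: sum_distrib_left mult.assoc)
  qed
  then have "(\<Sum>j<N. w j * cmod ((transpose_mat M *\<^sub>v u) $ j - (transpose_mat M *\<^sub>v v) $ j))
      \<le> (\<Sum>j<N. \<Sum>i<N. w j * cmod (M $$ (i, j)) * cmod (u $ i - v $ i))"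
    by (intro sum_mono) auto
  also have "\<dots> = (\<Sum>i<N. (\<Sum>j<N. w j * cmod (M $$ (i, j))) * cmod (u $ i - v $ i))"
    by (subst sum.swap) (simp add: sum_distrib_right)
  also have "\<dots> \<le> (\<Sum>i<N. q * w i * cmod (u $ i - v $ i))"
  proof (rule sum_mono)
    fix i assume "i \<in> {..<N}"
    then have "u $ i = v $ i \<or> (\<Sum>j<N. w j * cmod (M $$ (i, j))) \<le> q * w i" using rows by simp
    then show "(\<Sum>j<N. w j * cmod (M $$ (i, j))) * cmod (u $ i - v $ i) \<le> q * w i * cmod (u $ i - v $ i)"
      by (auto intro: mult_right_mono)
  qed
  finally show ?thesis by (simp add: sum_distrib_left mult.assoc)
qed

text \<open>Applied to a change of basis and to its inverse, this crude bound makes the norms before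
  and after comparable.\<close>

lemma l1_transpose_bound:
  fixes M :: "complex Matrix.mat"
  assumes M: "M \<in> carrier_mat N N"
  obtains B where "0 \<le> B" "\<And>u v. u \<in> carrier_vec N \<Longrightarrow> v \<in> carrier_vec N \<Longrightarrow>
    (\<Sum>j<N. cmod ((transpose_mat M *\<^sub>v u) $ j - (transpose_mat M *\<^sub>v v) $ j))
      \<le> B * (\<Sum>i<N. cmod (u $ i - v $ i))"
proof
  let ?B = "\<Sum>i<N. \<Sum>j<N. cmod (M $$ (i, j))"
  show "0 \<le> ?B" by (intro sum_nonneg) auto
  fix u v :: "complex Matrix.vec" assume uv: "u \<in> carrier_vec N" "v \<in> carrier_vec N"
  have "(\<Sum>j<N. cmod (M $$ (i, j))) \<le> ?B" if "i < N" for i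
    using that by (intro member_le_sum[where f = "\<lambda>i. \<Sum>j<N. cmod (M $$ (i, j))"] sum_nonneg) auto
  then show "(\<Sum>j<N. cmod ((transpose_mat M *\<^sub>v u) $ j - (transpose_mat M *\<^sub>v v) $ j))
      \<le> ?B * (\<Sum>i<N. cmod (u $ i - v $ i))"
    using weighted_l1_transpose_le[OF M uv, of "\<lambda>_. 1" ?B] by simp
qed

section \<open>The matrices of representation (b): contraction, fixed rows and overlap\<close>

lemma M0_b_carrier: "M0_b n t \<in> carrier_mat (n + 1) (n + 1)"
  and M1_b_carrier: "M1_b n t \<in> carrier_mat (n + 1) (n + 1)"
  by (simp_all add: M0_b_def M1_b_def)

lemma M0_b_weighted_row:
  assumes "cmod t < 1" "0 \<le> \<epsilon>" "1 \<le> i" "i < n + 1"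
  shows "(\<Sum>j<n + 1. \<epsilon> ^ j * cmod (M0_b n t $$ (i, j))) \<le> cmod t * \<epsilon> ^ i"
proof -
  have "(\<Sum>j<n + 1. \<epsilon> ^ j * cmod (M0_b n t $$ (i, j)))
      = (\<Sum>j<n + 1. if i = j then \<epsilon> ^ i * cmod t ^ i else 0)"
    using assms by (intro sum.cong) (auto simp: M0_b_def norm_power)
  also have "\<dots> = \<epsilon> ^ i * cmod t ^ i" using assms by simp
  also have "\<dots> \<le> \<epsilon> ^ i * cmod t ^ 1"
    using assms by (intro mult_left_mono power_decreasing) auto
  finally show ?thesis by (simp add: mult.commute)
qed

text \<open>By the binomial theorem the row sum equals \<open>\<epsilon> ^ i * cmod (1 - t) ^ i * (1
  + \<epsilon> * cmod t) ^ (n - i)\<close>. As \<open>1 \<le> i\<close>, one factor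
  \<open>cmod (1 - t)\<close> can be kept, and the last factor is close to 1 for small
  \<epsilon>.\<close>

lemma M1_b_weighted_row:
  assumes "cmod t < 1" "cmod (1 - t) < 1" "0 \<le> \<epsilon>" "1 \<le> i" "i < n + 1"
  shows "(\<Sum>j<n + 1. \<epsilon> ^ j * cmod (M1_b n t $$ (i, j))) \<le> cmod (1 - t) * (1 + \<epsilon>) ^ n * \<epsilon> ^ i"
proof -
  have "(\<Sum>j<n + 1. \<epsilon> ^ j * cmod (M1_b n t $$ (i, j)))
      = (\<Sum>j=i..n. \<epsilon> ^ j * (real ((n - i) choose (n - j)) * cmod t ^ (j - i) * cmod (1 - t) ^ i))"
    using assms by (intro sum.mono_neutral_cong_right)
      (auto simp: M1_b_def norm_power norm_mult)
  also have "\<dots> = (\<Sum>k\<le>n - i. \<epsilon> ^ (k + i) * (real ((n - i) choose k) * cmod t ^ k * cmod (1 - t) ^ i))"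
  proof (rule sum.reindex_bij_witness[of _ "\<lambda>k. k + i" "\<lambda>j. j - i"])
    fix j assume j: "j \<in> {i..n}"
    then have "(n - i) choose (j - i) = (n - i) choose (n - j)"
      by (subst binomial_symmetric) auto
    then show "\<epsilon> ^ (j - i + i) * (real ((n - i) choose (j - i)) * cmod t ^ (j - i) * cmod (1 - t) ^ i)
      = \<epsilon> ^ j * (real ((n - i) choose (n - j)) * cmod t ^ (j - i) * cmod (1 - t) ^ i)"
      using j by simp
  qed (use assms in auto)
  also have "\<dots> = \<epsilon> ^ i * cmod (1 - t) ^ i * (\<Sum>k\<le>n - i. real ((n - i) choose k) * (\<epsilon> * cmod t) ^ k)"
    by (simp add: sum_distrib_left power_add power_mult_distrib mult_ac)
  also have "(\<Sum>k\<le>n - i. real ((n - i) choose k) * (\<epsilon> * cmod t) ^ k) = (1 + \<epsilon> * cmod t) ^ (n - i)"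
    using binomial_ring[of "\<epsilon> * cmod t" 1 "n - i"] by (simp add: add.commute)
  also have "\<epsilon> ^ i * cmod (1 - t) ^ i * (1 + \<epsilon> * cmod t) ^ (n - i)
      \<le> \<epsilon> ^ i * cmod (1 - t) ^ 1 * (1 + \<epsilon>) ^ n"
  proof (rule mult_mono[OF mult_left_mono[OF power_decreasing]])
    have "\<epsilon> * cmod t \<le> \<epsilon>" using assms mult_left_mono[of "cmod t" 1 \<epsilon>] by simp
    then have "(1 + \<epsilon> * cmod t) ^ (n - i) \<le> (1 + \<epsilon>) ^ (n - i)"
      using assms by (intro power_mono) auto
    also have "\<dots> \<le> (1 + \<epsilon>) ^ n" using assms by (intro power_increasing) auto
    finally show "(1 + \<epsilon> * cmod t) ^ (n - i) \<le> (1 + \<epsilon>) ^ n" .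
  qed (use assms in auto)
  finally show ?thesis by (simp add: mult_ac)
qed

text \<open>Trinomial revision, in the form in which the entries of \<open>M1_b\<close> meet those
  of \<open>curve_end\<close>.\<close>

lemma choose_mult_symmetric:
  assumes "i \<le> j" "j \<le> n"
  shows "((n - i) choose (n - j)) * (n choose i) = (n choose j) * (j choose i)"
proof -
  have "(n - i) choose (n - j) = (n - i) choose (j - i)"
    using assms by (subst binomial_symmetric) auto
  then show ?thesis using choose_mult[OF assms] by (simp add: mult.commute)
qed

text \<open>The rows \<open>w(s) = ((n choose j) s\<^sup>j)\<^sub>j\<close> satisfy \<open>w(s) M\<^sup>(\<^sup>0\<^sup>) = w(t s)\<close> and
  \<open>w(s) M\<^sup>(\<^sup>1\<^sup>) = w(t + (1 - t) s)\<close>; the fixed rows are \<open>w(0)\<close>, a unit vector, and \<open>w(1)\<close>.\<close>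

definition curve_end :: "nat \<Rightarrow> complex Matrix.vec" where
  "curve_end n = Matrix.vec (n + 1) (\<lambda>j. of_nat (n choose j))"

lemma M0_b_fixes_start: "transpose_mat (M0_b n t) *\<^sub>v unit_vec (n + 1) 0 = unit_vec (n + 1) 0"
proof (rule eq_vecI)
  fix j assume "j < dim_vec (unit_vec (n + 1) 0 :: complex Matrix.vec)"
  then have j: "j < n + 1" by simp
  have "(transpose_mat (M0_b n t) *\<^sub>v unit_vec (n + 1) 0) $ j
      = (\<Sum>i<n + 1. if i = 0 then M0_b n t $$ (0, j) else 0)"
    unfolding index_transpose_mult_mat_vec[OF M0_b_carrier unit_vec_carrier j]
    by (rule sum.cong) auto
  then show "(transpose_mat (M0_b n t) *\<^sub>v unit_vec (n + 1) 0) $ j = unit_vec (n + 1) 0 $ j"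
    using j by (simp add: M0_b_def)
qed (simp add: M0_b_def)

lemma M1_b_fixes_end: "transpose_mat (M1_b n t) *\<^sub>v curve_end n = curve_end n"
proof (rule eq_vecI)
  fix j assume "j < dim_vec (curve_end n)"
  then have j: "j < n + 1" by (simp add: curve_end_def)
  have c: "curve_end n \<in> carrier_vec (n + 1)" by (simp add: curve_end_def)
  have "(transpose_mat (M1_b n t) *\<^sub>v curve_end n) $ j
      = (\<Sum>i\<le>j. of_nat (n choose j) * (of_nat (j choose i) * (1 - t) ^ i * t ^ (j - i)))"
    unfolding index_transpose_mult_mat_vec[OF M1_b_carrier c j]
  proof (rule sum.mono_neutral_cong_right)
    show "\<forall>i\<in>{..<n + 1} - {..j}. M1_b n t $$ (i, j) * curve_end n $ i = 0"
      using j by (auto simp: M1_b_def)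
    fix i assume i: "i \<in> {..j}"
    have "of_nat ((n - i) choose (n - j)) * of_nat (n choose i)
        = (of_nat (n choose j) * of_nat (j choose i) :: complex)"
      using choose_mult_symmetric[of i j n] i j
      by (simp only: of_nat_mult[symmetric]) simp
    then show "M1_b n t $$ (i, j) * curve_end n $ i
        = of_nat (n choose j) * (of_nat (j choose i) * (1 - t) ^ i * t ^ (j - i))"
      using i j by (simp add: M1_b_def curve_end_def mult_ac)
  qed (use j in auto)
  also have "\<dots> = of_nat (n choose j) * ((1 - t) + t) ^ j"
    unfolding binomial_ring[of "1 - t" t j] by (rule sum_distrib_left[symmetric])
  finally show "(transpose_mat (M1_b n t) *\<^sub>v curve_end n) $ j = curve_end n $ j"
    using j by (simp add: curve_end_def)
qed (simp add: M1_b_def curve_end_def)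

text \<open>Both sides are the row \<open>w(t)\<close>: the subdivision point is the end of the
  first piece of the curve and the start of the second.\<close>

lemma M0_b_end_eq_M1_b_start:
  "transpose_mat (M0_b n t) *\<^sub>v curve_end n = transpose_mat (M1_b n t) *\<^sub>v unit_vec (n + 1) 0"
proof (rule eq_vecI)
  fix j assume "j < dim_vec (transpose_mat (M1_b n t) *\<^sub>v unit_vec (n + 1) 0)"
  then have j: "j < n + 1" by (simp add: M1_b_def)
  have c: "curve_end n \<in> carrier_vec (n + 1)" by (simp add: curve_end_def)
  have "(transpose_mat (M0_b n t) *\<^sub>v curve_end n) $ j
      = (\<Sum>i<n + 1. if i = j then t ^ j * of_nat (n choose j) else 0)"
    unfolding index_transpose_mult_mat_vec[OF M0_b_carrier c j]
    using j by (intro sum.cong) (auto simp: M0_b_def curve_end_def)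
  also have "\<dots> = t ^ j * of_nat (n choose j)" using j by simp
  also have "\<dots> = (\<Sum>i<n + 1. if i = 0 then M1_b n t $$ (0, j) else 0)"
    using j binomial_symmetric[of j n] by (simp add: M1_b_def mult.commute)
  also have "\<dots> = (transpose_mat (M1_b n t) *\<^sub>v unit_vec (n + 1) 0) $ j"
    unfolding index_transpose_mult_mat_vec[OF M1_b_carrier unit_vec_carrier j]
    by (rule sum.cong) auto
  finally show "(transpose_mat (M0_b n t) *\<^sub>v curve_end n) $ j
    = (transpose_mat (M1_b n t) *\<^sub>v unit_vec (n + 1) 0) $ j" .
qed (simp add: M0_b_def M1_b_def)

section \<open>Transfer to conjugate systems\<close>

text \<open>A chart \<phi> onto the hyperplane of rows with first entry 1 that conjugates the maps
  to \<open>M0_b\<close>, \<open>M1_b\<close> and distorts distances boundedly pulls the weighted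
  norm back to a distance meeting the locale assumptions. Both representations are
  instances.\<close>

lemma conjugate_attractor:
  fixes \<phi> :: "complex Matrix.vec \<Rightarrow> complex Matrix.vec"
  assumes t: "cmod t < 1" "cmod (1 - t) < 1"
    and bij: "bij_betw \<phi> (carrier_vec n) {u \<in> carrier_vec (n + 1). u $ 0 = 1}"
    and f0: "\<And>x. x \<in> carrier_vec n \<Longrightarrow> f0 x \<in> carrier_vec n"
      "\<And>x. x \<in> carrier_vec n \<Longrightarrow> \<phi> (f0 x) = transpose_mat (M0_b n t) *\<^sub>v \<phi> x"
    and f1: "\<And>x. x \<in> carrier_vec n \<Longrightarrow> f1 x \<in> carrier_vec n"
      "\<And>x. x \<in> carrier_vec n \<Longrightarrow> \<phi> (f1 x) = transpose_mat (M1_b n t) *\<^sub>v \<phi> x"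
    and c: "0 \<le> c"
    and low: "\<And>x y. x \<in> carrier_vec n \<Longrightarrow> y \<in> carrier_vec n \<Longrightarrow>
      complex_vec_dist n x y \<le> c * (\<Sum>j<n + 1. cmod (\<phi> x $ j - \<phi> y $ j))"
    and up: "\<And>x y. x \<in> carrier_vec n \<Longrightarrow> y \<in> carrier_vec n \<Longrightarrow>
      (\<Sum>j<n + 1. cmod (\<phi> x $ j - \<phi> y $ j)) \<le> C * complex_vec_dist n x y"
  shows "(\<exists>!A. is_attractor (complex_vec_metric n) f0 f1 A) \<and>
    (\<forall>A. is_attractor (complex_vec_metric n) f0 f1 A \<longrightarrow>
      connectedin (mtopology_of (complex_vec_metric n)) A)"
proof -
  have \<phi>: "\<phi> x \<in> carrier_vec (n + 1)" "\<phi> x $ 0 = 1" if "x \<in> carrier_vec n" for x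
    using bij_betwE[OF bij] that by auto
  \<comment> \<open>The weight \<epsilon> is taken close to 0, where the row bound of
    \<open>M1_b_weighted_row\<close> tends to \<open>cmod (1 - t) < 1\<close>.\<close>
  have "((\<lambda>\<epsilon>. cmod (1 - t) * (1 + \<epsilon>) ^ n) \<longlongrightarrow> cmod (1 - t) * (1 + 0) ^ n) (at_right 0)"
    by (intro tendsto_intros)
  then have "eventually (\<lambda>\<epsilon>. cmod (1 - t) * (1 + \<epsilon>) ^ n < 1) (at_right (0::real))"
    by (rule order_tendstoD) (use t in simp)
  moreover have "eventually (\<lambda>\<epsilon>. 0 < \<epsilon> \<and> \<epsilon> < 1) (at_right (0::real))"
    using eventually_at_right_real[of 0 1] by simp
  ultimately have "eventually (\<lambda>\<epsilon>. cmod (1 - t) * (1 + \<epsilon>) ^ n < 1 \<and> 0 < \<epsilon> \<and> \<epsilon> < 1) (at_right (0::real))"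
    by eventually_elim auto
  then obtain \<epsilon> :: real where \<epsilon>: "cmod (1 - t) * (1 + \<epsilon>) ^ n < 1" "0 < \<epsilon>" "\<epsilon> < 1"
    using eventually_happens'[OF trivial_limit_at_right_real] by blast
  define q where "q = max (cmod t) (cmod (1 - t) * (1 + \<epsilon>) ^ n)"
  \<comment> \<open>\<open>\<epsilon> ^ n\<close> is the smallest weight, so \<open>S\<close> is at
    least \<open>\<epsilon> ^ n\<close> times the unweighted sum; the factor \<open>K\<close> makes
    \<open>K * S\<close> dominate the Euclidean distance.\<close>
  define K where "K = c / \<epsilon> ^ n"
  define S where "S x y = (\<Sum>j<n + 1. \<epsilon> ^ j * cmod (\<phi> x $ j - \<phi> y $ j))" for x y
  have K: "0 \<le> K" using c \<epsilon> by (simp add: K_def)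
  have contr: "S (f x) (f y) \<le> q * S x y"
    if xy: "x \<in> carrier_vec n" "y \<in> carrier_vec n" and M: "M \<in> carrier_mat (n + 1) (n + 1)"
      and f: "\<And>x. x \<in> carrier_vec n \<Longrightarrow> \<phi> (f x) = transpose_mat M *\<^sub>v \<phi> x"
      and rows: "\<And>i. 1 \<le> i \<Longrightarrow> i < n + 1 \<Longrightarrow> (\<Sum>j<n + 1. \<epsilon> ^ j * cmod (M $$ (i, j))) \<le> q * \<epsilon> ^ i"
    for x y f M
  proof -
    \<comment> \<open>Coordinate 0 equals 1 at both points, so only the rows from 1 on have to be
      bounded.\<close>
    have "\<phi> x $ i = \<phi> y $ i \<or> (\<Sum>j<n + 1. \<epsilon> ^ j * cmod (M $$ (i, j))) \<le> q * \<epsilon> ^ i"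
      if "i < n + 1" for i
      using that rows[of i] \<phi> xy by (cases "i = 0") auto
    then show ?thesis
      unfolding S_def f[OF xy(1)] f[OF xy(2)]
      using \<epsilon> by (intro weighted_l1_transpose_le M \<phi>(1) xy) auto
  qed
  have "(\<Sum>j<n + 1. \<epsilon> ^ j * cmod (M0_b n t $$ (i, j))) \<le> q * \<epsilon> ^ i" if "1 \<le> i" "i < n + 1" for i
    by (rule order_trans[OF M0_b_weighted_row[OF t(1) _ that]])
      (use \<epsilon> in \<open>auto simp: q_def intro!: mult_right_mono\<close>)
  then have contr0: "S (f0 x) (f0 y) \<le> q * S x y" if "x \<in> carrier_vec n" "y \<in> carrier_vec n" for x y
    using contr[OF that M0_b_carrier f0(2)] by blast
  have "(\<Sum>j<n + 1. \<epsilon> ^ j * cmod (M1_b n t $$ (i, j))) \<le> q * \<epsilon> ^ i" if "1 \<le> i" "i < n + 1" for i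
    by (rule order_trans[OF M1_b_weighted_row[OF t _ that]])
      (use \<epsilon> in \<open>auto simp: q_def intro!: mult_right_mono\<close>)
  then have contr1: "S (f1 x) (f1 y) \<le> q * S x y" if "x \<in> carrier_vec n" "y \<in> carrier_vec n" for x y
    using contr[OF that M1_b_carrier f1(2)] by blast
  have inj: "x = y" if "x \<in> carrier_vec n" "y \<in> carrier_vec n" "\<phi> x = \<phi> y" for x y
    using bij that by (auto simp: bij_betw_def inj_on_def)
  \<comment> \<open>The fixed rows \<open>w(0)\<close> and \<open>w(1)\<close> have first entry 1,
    hence lie in the image of \<phi>; their preimages are the end points of the curve.\<close>
  have "unit_vec (n + 1) 0 \<in> \<phi> ` carrier_vec n" "curve_end n \<in> \<phi> ` carrier_vec n"
    using bij by (auto simp: bij_betw_def curve_end_def)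
  then obtain z0 z1 where z: "z0 \<in> carrier_vec n" "\<phi> z0 = unit_vec (n + 1) 0"
    "z1 \<in> carrier_vec n" "\<phi> z1 = curve_end n"
    by (metis imageE)
  have S_le: "S x y \<le> (\<Sum>j<n + 1. cmod (\<phi> x $ j - \<phi> y $ j))" for x y
    unfolding S_def using \<epsilon> by (intro sum_mono mult_left_le_one_le) (auto intro: power_le_one)
  have S_ge: "\<epsilon> ^ n * (\<Sum>j<n + 1. cmod (\<phi> x $ j - \<phi> y $ j)) \<le> S x y" for x y
    unfolding S_def sum_distrib_left using \<epsilon>
    by (intro sum_mono mult_right_mono power_decreasing) auto
  have S_tri: "S x z \<le> S x y + S y z" for x y z
  proof -
    have "cmod (\<phi> x $ j - \<phi> z $ j) \<le> cmod (\<phi> x $ j - \<phi> y $ j) + cmod (\<phi> y $ j - \<phi> z $ j)" for j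
      using norm_triangle_ineq[of "\<phi> x $ j - \<phi> y $ j" "\<phi> y $ j - \<phi> z $ j"] by simp
    then show ?thesis
      unfolding S_def sum.distrib[symmetric] distrib_left[symmetric]
      using \<epsilon> by (intro sum_mono mult_left_mono) auto
  qed
  interpret contractive_ifs "complex_vec_metric n" f0 f1 "\<lambda>x y. K * S x y" "K * C" q z0 z1
  proof (unfold_locales, simp_all only: mspace_complex_vec_metric mdist_complex_vec_metric)
    show "mcomplete_of (complex_vec_metric n)" by (rule mcomplete_complex_vec_metric)
    fix x y z :: "complex Matrix.vec"
    assume x: "x \<in> carrier_vec n"
    then show "f0 x \<in> carrier_vec n" "f1 x \<in> carrier_vec n" using f0 f1 by auto
    assume y: "y \<in> carrier_vec n"
    have "complex_vec_dist n x y \<le> c * (\<Sum>j<n + 1. cmod (\<phi> x $ j - \<phi> y $ j))" using low x y by simp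
    also have "\<dots> = K * (\<epsilon> ^ n * (\<Sum>j<n + 1. cmod (\<phi> x $ j - \<phi> y $ j)))"
      using \<epsilon> by (simp add: K_def)
    also have "\<dots> \<le> K * S x y" using S_ge K by (rule mult_left_mono)
    finally show "complex_vec_dist n x y \<le> K * S x y" .
    have "S x y \<le> C * complex_vec_dist n x y" using S_le up[OF x y] by (rule order_trans)
    then show "K * S x y \<le> K * C * complex_vec_dist n x y"
      using K by (simp add: mult_left_mono mult.assoc)
    show "K * S x z \<le> K * S x y + K * S y z"
      using mult_left_mono[OF S_tri K] by (simp add: distrib_left)
    show "K * S (f0 x) (f0 y) \<le> q * (K * S x y)" "K * S (f1 x) (f1 y) \<le> q * (K * S x y)"
      using mult_left_mono[OF contr0[OF x y] K] mult_left_mono[OF contr1[OF x y] K]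
      by (simp_all add: mult.left_commute)
  next
    show "0 \<le> q" "q < 1" using t \<epsilon> by (auto simp: q_def max_def)
    show "z0 \<in> carrier_vec n" "z1 \<in> carrier_vec n" using z by auto
    have "\<phi> (f0 z0) = \<phi> z0" unfolding f0(2)[OF z(1)] z(2) by (rule M0_b_fixes_start)
    then show "f0 z0 = z0" using f0(1) z inj by blast
    have "\<phi> (f1 z1) = \<phi> z1" unfolding f1(2)[OF z(3)] z(4) by (rule M1_b_fixes_end)
    then show "f1 z1 = z1" using f1(1) z inj by blast
    have "\<phi> (f0 z1) = \<phi> (f1 z0)"
      unfolding f0(2)[OF z(3)] f1(2)[OF z(1)] z(2,4) by (rule M0_b_end_eq_M1_b_start)
    then show "f0 z1 = f1 z0" using f0(1) f1(1) z inj by blast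
  qed
  show ?thesis by (rule unique_connected_attractor)
qed

section \<open>Conjugacy of the two representations\<close>

definition lift_a :: "nat \<Rightarrow> complex Matrix.vec \<Rightarrow> complex Matrix.vec" where
  "lift_a n x = Matrix.vec (n + 1) (\<lambda>i. if i < n then x $ i else 1)"

definition lift_b :: "nat \<Rightarrow> complex Matrix.vec \<Rightarrow> complex Matrix.vec" where
  "lift_b n x = Matrix.vec (n + 1) (\<lambda>i. if i = 0 then 1 else x $ (i - 1))"

lemma lift_carrier [simp]: "lift_a n x \<in> carrier_vec (n + 1)" "lift_b n x \<in> carrier_vec (n + 1)"
  by (simp_all add: lift_a_def lift_b_def)

lemma affine_map_carrier:
  assumes "M \<in> carrier_mat (n + 1) (n + 1)"
  shows "affine_map_a n M x \<in> carrier_vec n" "affine_map_b n M x \<in> carrier_vec n"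
  using assms by (auto simp: affine_map_a_def affine_map_b_def split_block_def Let_def intro!: carrier_vecI)

text \<open>The last column of \<open>M\<close> is a unit vector, which keeps the final coordinate
  equal to 1; the other columns carry the blocks of the affine map.\<close>

lemma lift_affine_map_a:
  assumes M: "M \<in> carrier_mat (n + 1) (n + 1)"
    and col: "\<And>i. i \<le> n \<Longrightarrow> M $$ (i, n) = (if i = n then 1 else 0)"
    and x: "x \<in> carrier_vec n"
  shows "lift_a n (affine_map_a n M x) = transpose_mat M *\<^sub>v lift_a n x"
proof (rule eq_vecI)
  fix j assume "j < dim_vec (transpose_mat M *\<^sub>v lift_a n x)"
  then have j: "j < n + 1" using M by simp
  have rhs: "(transpose_mat M *\<^sub>v lift_a n x) $ j = (\<Sum>i<n. M $$ (i, j) * x $ i) + M $$ (n, j)"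
    unfolding index_transpose_mult_mat_vec[OF M lift_carrier(1) j] by (simp add: lift_a_def)
  show "lift_a n (affine_map_a n M x) $ j = (transpose_mat M *\<^sub>v lift_a n x) $ j"
  proof (cases "j < n")
    case True
    then show ?thesis
      unfolding rhs using M x
      by (simp add: lift_a_def affine_map_a_def split_block_def Let_def scalar_prod_def atLeast0LessThan)
  next
    case False
    then have "j = n" using j by simp
    then show ?thesis unfolding rhs using col by (simp add: lift_a_def)
  qed
qed (use M in \<open>simp add: lift_a_def\<close>)

lemma lift_affine_map_b:
  assumes M: "M \<in> carrier_mat (n + 1) (n + 1)"
    and col: "\<And>i. i \<le> n \<Longrightarrow> M $$ (i, 0) = (if i = 0 then 1 else 0)"
    and x: "x \<in> carrier_vec n"
  shows "lift_b n (affine_map_b n M x) = transpose_mat M *\<^sub>v lift_b n x"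
proof (rule eq_vecI)
  fix j assume "j < dim_vec (transpose_mat M *\<^sub>v lift_b n x)"
  then have j: "j < n + 1" using M by simp
  have rhs: "(transpose_mat M *\<^sub>v lift_b n x) $ j = M $$ (0, j) + (\<Sum>i<n. M $$ (Suc i, j) * x $ i)"
    unfolding index_transpose_mult_mat_vec[OF M lift_carrier(2) j] Suc_eq_plus1[symmetric] sum.lessThan_Suc_shift
    by (simp add: lift_b_def)
  show "lift_b n (affine_map_b n M x) $ j = (transpose_mat M *\<^sub>v lift_b n x) $ j"
  proof (cases j)
    case (Suc k)
    then show ?thesis
      unfolding rhs using M x j
      by (simp add: lift_b_def affine_map_b_def split_block_def Let_def scalar_prod_def atLeast0LessThan)
  next
    case 0
    then show ?thesis unfolding rhs using col by (simp add: lift_b_def)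
  qed
qed (use M in \<open>simp add: lift_b_def\<close>)

lemma lift_diff_sum:
  "(\<Sum>j<n + 1. cmod (lift_a n x $ j - lift_a n y $ j)) = (\<Sum>i<n. cmod (x $ i - y $ i))"
  "(\<Sum>j<n + 1. cmod (lift_b n x $ j - lift_b n y $ j)) = (\<Sum>i<n. cmod (x $ i - y $ i))"
proof -
  show "(\<Sum>j<n + 1. cmod (lift_a n x $ j - lift_a n y $ j)) = (\<Sum>i<n. cmod (x $ i - y $ i))"
    by (simp add: lift_a_def)
  show "(\<Sum>j<n + 1. cmod (lift_b n x $ j - lift_b n y $ j)) = (\<Sum>i<n. cmod (x $ i - y $ i))"
    unfolding Suc_eq_plus1[symmetric] sum.lessThan_Suc_shift by (simp add: lift_b_def)
qed

lemma sum_le_complex_vec_dist: "(\<Sum>i<n. cmod (x $ i - y $ i)) \<le> n * complex_vec_dist n x y"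
  using sum_bounded_above[of "{..<n}" "\<lambda>i. cmod (x $ i - y $ i)" "complex_vec_dist n x y"]
    cmod_coord_le_complex_vec_dist by simp

lemma bij_betw_lift_b: "bij_betw (lift_b n) (carrier_vec n) {u \<in> carrier_vec (n + 1). u $ 0 = 1}"
proof (rule bij_betw_byWitness[where f' = "\<lambda>u. Matrix.vec n (\<lambda>i. u $ (i + 1))"])
  show "\<forall>u\<in>{u \<in> carrier_vec (n + 1). u $ 0 = 1}. lift_b n (Matrix.vec n (\<lambda>i. u $ (i + 1))) = u"
    by (auto simp: lift_b_def intro!: eq_vecI)
qed (auto simp: lift_b_def intro!: eq_vecI)

lemma bij_betw_lift_a: "bij_betw (lift_a n) (carrier_vec n) {v \<in> carrier_vec (n + 1). v $ n = 1}"
proof (rule bij_betw_byWitness[where f' = "\<lambda>v. Matrix.vec n (\<lambda>i. v $ i)"])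
  show "\<forall>v\<in>{v \<in> carrier_vec (n + 1). v $ n = 1}. lift_a n (Matrix.vec n (\<lambda>i. v $ i)) = v"
    by (auto simp: lift_a_def less_Suc_eq intro!: eq_vecI)
qed (auto simp: lift_a_def intro!: eq_vecI)

lemma attractor_b:
  assumes t: "cmod t < 1" "cmod (1 - t) < 1"
  shows "(\<exists>!A. is_attractor (complex_vec_metric n)
             (affine_map_b n (M0_b n t)) (affine_map_b n (M1_b n t)) A) \<and>
     (\<forall>A. is_attractor (complex_vec_metric n)
             (affine_map_b n (M0_b n t)) (affine_map_b n (M1_b n t)) A \<longrightarrow>
           connectedin (mtopology_of (complex_vec_metric n)) A)"
proof (rule conjugate_attractor[OF t bij_betw_lift_b])
  show "complex_vec_dist n x y \<le> 1 * (\<Sum>j<n + 1. cmod (lift_b n x $ j - lift_b n y $ j))" for x y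
    unfolding lift_diff_sum using complex_vec_dist_le_sum by simp
  show "(\<Sum>j<n + 1. cmod (lift_b n x $ j - lift_b n y $ j)) \<le> n * complex_vec_dist n x y" for x y
    unfolding lift_diff_sum by (rule sum_le_complex_vec_dist)
qed (simp_all add: affine_map_carrier M0_b_carrier[simplified] M1_b_carrier[simplified]
    lift_affine_map_b block_form_b)

section \<open>Representation (a) from a similarity with representation (b)\<close>

text \<open>The change of basis \<open>Q\<close> carries rows \<open>(x, 1)\<close> to rows
  \<open>(1, y)\<close>: as its column 0 is the last unit vector, entry 0 of the image is entry
  \<open>n\<close> of the source. So \<open>lift_a\<close> followed by \<open>Q\<close> is a chart
  as in \<open>conjugate_attractor\<close>; transposes appear because rows are written as
  columns.\<close>

lemma attractor_a_if_similar:
  assumes t: "cmod t < 1" "cmod (1 - t) < 1"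
    and M0: "M0 \<in> carrier_mat (n + 1) (n + 1)" "\<And>i. i \<le> n \<Longrightarrow> M0 $$ (i, n) = (if i = n then 1 else 0)"
    and M1: "M1 \<in> carrier_mat (n + 1) (n + 1)" "\<And>i. i \<le> n \<Longrightarrow> M1 $$ (i, n) = (if i = n then 1 else 0)"
    and Q: "Q \<in> carrier_mat (n + 1) (n + 1)" and R: "R \<in> carrier_mat (n + 1) (n + 1)"
    and QR: "Q * R = 1\<^sub>m (n + 1)" and RQ: "R * Q = 1\<^sub>m (n + 1)"
    and sim: "M0 * Q = Q * M0_b n t" "M1 * Q = Q * M1_b n t"
    and Q0: "\<And>i. i \<le> n \<Longrightarrow> Q $$ (i, 0) = (if i = n then 1 else 0)"
  shows "(\<exists>!A. is_attractor (complex_vec_metric n) (affine_map_a n M0) (affine_map_a n M1) A) \<and>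
     (\<forall>A. is_attractor (complex_vec_metric n) (affine_map_a n M0) (affine_map_a n M1) A \<longrightarrow>
           connectedin (mtopology_of (complex_vec_metric n)) A)"
proof -
  let ?\<phi> = "\<lambda>x. transpose_mat Q *\<^sub>v lift_a n x"
  have QT: "transpose_mat Q \<in> carrier_mat (n + 1) (n + 1)" and RT: "transpose_mat R \<in> carrier_mat (n + 1) (n + 1)"
    using Q R by simp_all
  have inv1: "transpose_mat R *\<^sub>v (transpose_mat Q *\<^sub>v v) = v" if v: "v \<in> carrier_vec (n + 1)" for v
  proof -
    have "transpose_mat R *\<^sub>v (transpose_mat Q *\<^sub>v v) = transpose_mat (Q * R) *\<^sub>v v"
      unfolding transpose_mult[OF Q R] by (rule assoc_mult_mat_vec[OF RT QT v, symmetric])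
    also have "\<dots> = 1\<^sub>m (n + 1) *\<^sub>v v" unfolding QR by simp
    also have "\<dots> = v" using v by (rule one_mult_mat_vec)
    finally show ?thesis .
  qed
  have inv2: "transpose_mat Q *\<^sub>v (transpose_mat R *\<^sub>v v) = v" if v: "v \<in> carrier_vec (n + 1)" for v
  proof -
    have "transpose_mat Q *\<^sub>v (transpose_mat R *\<^sub>v v) = transpose_mat (R * Q) *\<^sub>v v"
      unfolding transpose_mult[OF R Q] by (rule assoc_mult_mat_vec[OF QT RT v, symmetric])
    also have "\<dots> = 1\<^sub>m (n + 1) *\<^sub>v v" unfolding RQ by simp
    also have "\<dots> = v" using v by (rule one_mult_mat_vec)
    finally show ?thesis .
  qed
  have hyperplane: "(transpose_mat Q *\<^sub>v v) $ 0 = v $ n" if v: "v \<in> carrier_vec (n + 1)" for v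
  proof -
    have "(transpose_mat Q *\<^sub>v v) $ 0 = (\<Sum>i<n + 1. if i = n then v $ n else 0)"
      unfolding index_transpose_mult_mat_vec[OF Q v zero_less_Suc[of n, unfolded Suc_eq_plus1]]
      by (rule sum.cong) (auto simp: Q0)
    then show ?thesis by simp
  qed
  have "bij_betw (\<lambda>v. transpose_mat Q *\<^sub>v v) {v \<in> carrier_vec (n + 1). v $ n = 1}
      {u \<in> carrier_vec (n + 1). u $ 0 = 1}"
  proof (rule bij_betw_byWitness[where f' = "\<lambda>u. transpose_mat R *\<^sub>v u"])
    show "(\<lambda>v. transpose_mat Q *\<^sub>v v) ` {v \<in> carrier_vec (n + 1). v $ n = 1}
        \<subseteq> {u \<in> carrier_vec (n + 1). u $ 0 = 1}"
      using hyperplane mult_mat_vec_carrier[OF QT] by auto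
    show "(\<lambda>u. transpose_mat R *\<^sub>v u) ` {u \<in> carrier_vec (n + 1). u $ 0 = 1}
        \<subseteq> {v \<in> carrier_vec (n + 1). v $ n = 1}"
    proof clarify
      fix u :: "complex Matrix.vec" assume u: "u \<in> carrier_vec (n + 1)" "u $ 0 = 1"
      then have Ru: "transpose_mat R *\<^sub>v u \<in> carrier_vec (n + 1)" using mult_mat_vec_carrier[OF RT] by blast
      then show "transpose_mat R *\<^sub>v u \<in> carrier_vec (n + 1) \<and> (transpose_mat R *\<^sub>v u) $ n = 1"
        using hyperplane[OF Ru] inv2[OF u(1)] u(2) by simp
    qed
  qed (use inv1 inv2 in auto)
  then have bij: "bij_betw ?\<phi> (carrier_vec n) {u \<in> carrier_vec (n + 1). u $ 0 = 1}"
    using bij_betw_trans[OF bij_betw_lift_a] by (simp add: comp_def)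
  have semi: "?\<phi> (affine_map_a n M x) = transpose_mat T *\<^sub>v ?\<phi> x"
    if M: "M \<in> carrier_mat (n + 1) (n + 1)" "\<And>i. i \<le> n \<Longrightarrow> M $$ (i, n) = (if i = n then 1 else 0)"
      and T: "T \<in> carrier_mat (n + 1) (n + 1)" "M * Q = Q * T" and x: "x \<in> carrier_vec n" for M T x
  proof -
    have MT: "transpose_mat M \<in> carrier_mat (n + 1) (n + 1)" and TT: "transpose_mat T \<in> carrier_mat (n + 1) (n + 1)"
      using M T by simp_all
    have "?\<phi> (affine_map_a n M x) = transpose_mat Q *\<^sub>v (transpose_mat M *\<^sub>v lift_a n x)"
      by (simp only: lift_affine_map_a[OF M x])
    also have "\<dots> = transpose_mat (M * Q) *\<^sub>v lift_a n x"
      unfolding transpose_mult[OF M(1) Q] by (rule assoc_mult_mat_vec[OF QT MT lift_carrier(1), symmetric])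
    also have "\<dots> = transpose_mat T *\<^sub>v ?\<phi> x"
      unfolding T(2) transpose_mult[OF Q T(1)] by (rule assoc_mult_mat_vec[OF TT QT lift_carrier(1)])
    finally show ?thesis .
  qed
  obtain B where B: "0 \<le> B" "\<And>u v. u \<in> carrier_vec (n + 1) \<Longrightarrow> v \<in> carrier_vec (n + 1) \<Longrightarrow>
      (\<Sum>j<n + 1. cmod ((transpose_mat Q *\<^sub>v u) $ j - (transpose_mat Q *\<^sub>v v) $ j))
        \<le> B * (\<Sum>i<n + 1. cmod (u $ i - v $ i))"
    using l1_transpose_bound[OF Q] by blast
  obtain c where c: "0 \<le> c" "\<And>u v. u \<in> carrier_vec (n + 1) \<Longrightarrow> v \<in> carrier_vec (n + 1) \<Longrightarrow>
      (\<Sum>j<n + 1. cmod ((transpose_mat R *\<^sub>v u) $ j - (transpose_mat R *\<^sub>v v) $ j))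
        \<le> c * (\<Sum>i<n + 1. cmod (u $ i - v $ i))"
    using l1_transpose_bound[OF R] by blast
  \<comment> \<open>Applying \<open>R\<close> recovers the lifts from their images, so its norm
    bound \<open>c\<close> yields the lower estimate.\<close>
  have low: "complex_vec_dist n x y \<le> c * (\<Sum>j<n + 1. cmod (?\<phi> x $ j - ?\<phi> y $ j))" for x y
  proof -
    have "complex_vec_dist n x y \<le> (\<Sum>j<n + 1. cmod (lift_a n x $ j - lift_a n y $ j))"
      unfolding lift_diff_sum by (rule complex_vec_dist_le_sum)
    also have "\<dots> = (\<Sum>j<n + 1. cmod ((transpose_mat R *\<^sub>v ?\<phi> x) $ j - (transpose_mat R *\<^sub>v ?\<phi> y) $ j))"
      by (simp only: inv1[OF lift_carrier(1)])
    also have "\<dots> \<le> c * (\<Sum>j<n + 1. cmod (?\<phi> x $ j - ?\<phi> y $ j))"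
      by (intro c(2) mult_mat_vec_carrier[OF QT] lift_carrier)
    finally show ?thesis .
  qed
  have up: "(\<Sum>j<n + 1. cmod (?\<phi> x $ j - ?\<phi> y $ j)) \<le> (B * n) * complex_vec_dist n x y" for x y
  proof -
    have "(\<Sum>j<n + 1. cmod (?\<phi> x $ j - ?\<phi> y $ j)) \<le> B * (\<Sum>i<n. cmod (x $ i - y $ i))"
      using B(2)[OF lift_carrier(1) lift_carrier(1), of x y] unfolding lift_diff_sum .
    also have "\<dots> \<le> B * (n * complex_vec_dist n x y)"
      by (rule mult_left_mono[OF sum_le_complex_vec_dist B(1)])
    finally show ?thesis by (simp add: mult.assoc)
  qed
  show ?thesis
    by (rule conjugate_attractor[OF t bij affine_map_carrier(1)[OF M0(1)] semi[OF M0 M0_b_carrier sim(1)]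
          affine_map_carrier(1)[OF M1(1)] semi[OF M1 M1_b_carrier sim(2)] c(1) low up])
qed

section \<open>The change between the Bernstein and the scaled power basis\<close>

text \<open>The lower triangular Pascal matrix; column \<open>j\<close> lists the Bernstein
  coefficients of degree \<open>n\<close> of \<open>(n choose j) * s ^ j\<close>.\<close>

definition binomial_mat :: "nat \<Rightarrow> complex Matrix.mat" where
  "binomial_mat n = Matrix.mat (n + 1) (n + 1) (\<lambda>(i, j). of_nat (i choose j))"

lemma binomial_mat_carrier: "binomial_mat n \<in> carrier_mat (n + 1) (n + 1)"
  by (simp add: binomial_mat_def)

text \<open>The matrix is triangular with unit diagonal, so its determinant is 1.\<close>

lemma binomial_mat_inverse:
  obtains R where "R \<in> carrier_mat (n + 1) (n + 1)"
    "binomial_mat n * R = 1\<^sub>m (n + 1)" "R * binomial_mat n = 1\<^sub>m (n + 1)"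
proof -
  have "det (binomial_mat n) = prod_list (diag_mat (binomial_mat n))"
    by (rule det_lower_triangular[OF _ binomial_mat_carrier]) (simp add: binomial_mat_def binomial_eq_0)
  also have "diag_mat (binomial_mat n) = map (\<lambda>i. 1) [0..<n + 1]"
    unfolding diag_mat_def by (rule map_cong) (auto simp: binomial_mat_def)
  also have "prod_list (map (\<lambda>i. 1 :: complex) [0..<n + 1]) = 1"
    by (simp add: map_replicate_const)
  finally have "binomial_mat n \<in> Units (ring_mat TYPE(complex) (n + 1) ())"
    by (intro det_non_zero_imp_unit[OF binomial_mat_carrier]) simp
  then show thesis
    using that by (auto simp: Units_def ring_mat_def)
qed

lemma casteljau_carrier:
  "casteljau_L n t \<in> carrier_mat (n + 1) (n + 1)" "casteljau_R n t \<in> carrier_mat (n + 1) (n + 1)"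
  by (simp_all add: casteljau_L_def casteljau_R_def)

lemma index_mult_mat_sum:
  assumes "A \<in> carrier_mat N N" "B \<in> carrier_mat N N" "i < N" "j < N"
  shows "(A * B) $$ (i, j) = (\<Sum>k<N. A $$ (i, k) * B $$ (k, j))"
  using assms by (simp add: scalar_prod_def atLeast0LessThan)

text \<open>Formally the binomial moments of the binomial distribution: trinomial revision extracts
  \<open>(m choose j) * t ^ j\<close> and leaves the full sum of Bernstein polynomials of degree
  \<open>m - j\<close>, which is 1.\<close>

lemma sum_bernstein_choose:
  "(\<Sum>k\<le>m. bernstein m k t * of_nat (k choose j)) = of_nat (m choose j) * t ^ j"
proof (cases "j \<le> m")
  case True
  have "(\<Sum>k\<le>m. bernstein m k t * of_nat (k choose j))
      = (\<Sum>k=j..m. of_nat (m choose j) * t ^ j * bernstein (m - j) (k - j) t)"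
  proof (rule sum.mono_neutral_cong_right)
    show "\<forall>k\<in>{..m} - {j..m}. bernstein m k t * of_nat (k choose j) = 0"
      by (auto simp: binomial_eq_0)
    fix k assume k: "k \<in> {j..m}"
    then have "of_nat (m choose k) * of_nat (k choose j)
        = (of_nat (m choose j) * of_nat ((m - j) choose (k - j)) :: complex)"
      using choose_mult[of j k m] by (simp only: of_nat_mult[symmetric]) simp
    moreover have "t ^ k = t ^ j * t ^ (k - j)" "m - j - (k - j) = m - k"
      using k by (simp_all add: power_add[symmetric])
    ultimately show "bernstein m k t * of_nat (k choose j)
        = of_nat (m choose j) * t ^ j * bernstein (m - j) (k - j) t"
      by (simp add: bernstein_def mult_ac)
  qed auto
  also have "\<dots> = of_nat (m choose j) * t ^ j * (\<Sum>k\<le>m - j. bernstein (m - j) k t)"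
    unfolding sum_distrib_left[symmetric]
    by (intro arg_cong[where f = "(*) _"] sum.reindex_bij_witness[of _ "\<lambda>k. k + j" "\<lambda>k. k - j"])
      (use True in auto)
  finally show ?thesis by (simp add: sum_bernstein)
next
  case False
  then show ?thesis by (simp add: binomial_eq_0)
qed

text \<open>Entry \<open>(i, j)\<close> of either product is \<open>(i choose j) * t ^ j\<close>: on
  the left by \<open>sum_bernstein_choose\<close> with \<open>m = i\<close>, on the right because
  the diagonal matrix \<open>M0_b\<close> scales column \<open>j\<close>.\<close>

lemma casteljau_L_similar: "casteljau_L n t * binomial_mat n = binomial_mat n * M0_b n t"
proof (rule eq_matI)
  fix i j assume "i < dim_row (binomial_mat n * M0_b n t)" "j < dim_col (binomial_mat n * M0_b n t)"
  then have ij: "i < n + 1" "j < n + 1" by (simp_all add: binomial_mat_def M0_b_def)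
  have "(casteljau_L n t * binomial_mat n) $$ (i, j) = (\<Sum>k\<le>i. bernstein i k t * of_nat (k choose j))"
    unfolding index_mult_mat_sum[OF casteljau_carrier(1) binomial_mat_carrier ij]
    by (rule sum.mono_neutral_cong_right) (use ij in \<open>auto simp: casteljau_L_def binomial_mat_def\<close>)
  also have "\<dots> = (\<Sum>k<n + 1. if k = j then of_nat (i choose j) * t ^ j else 0)"
    unfolding sum_bernstein_choose using ij by simp
  also have "\<dots> = (binomial_mat n * M0_b n t) $$ (i, j)"
    unfolding index_mult_mat_sum[OF binomial_mat_carrier M0_b_carrier ij]
    by (rule sum.cong) (use ij in \<open>auto simp: M0_b_def binomial_mat_def\<close>)
  finally show "(casteljau_L n t * binomial_mat n) $$ (i, j) = (binomial_mat n * M0_b n t) $$ (i, j)" .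
qed (simp_all add: casteljau_L_def binomial_mat_def M0_b_def)

text \<open>Both sides of the \<open>i\<close>th row, read as coefficients of polynomials in \<open>x\<close>, give
  \<open>(1 + x)\<^sup>i (1 + t x)\<^sup>n\<^sup>-\<^sup>i\<close>.\<close>

lemma casteljau_R_similar: "casteljau_R n t * binomial_mat n = binomial_mat n * M1_b n t"
proof (rule eq_matI)
  fix i j assume "i < dim_row (binomial_mat n * M1_b n t)" "j < dim_col (binomial_mat n * M1_b n t)"
  then have i: "i < n + 1" and j: "j \<le> n" by (simp_all add: binomial_mat_def M1_b_def)
  let ?l = "\<lambda>j. \<Sum>k=i..n. bernstein (n - i) (k - i) t * of_nat (k choose j)"
  let ?r = "\<lambda>j. \<Sum>l\<le>n. of_nat (i choose l) * M1_b n t $$ (l, j)"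
  have "(\<Sum>j\<le>n. ?l j * x ^ j) = (\<Sum>j\<le>n. ?r j * x ^ j)" for x
  proof -
    have row: "(\<Sum>j\<le>n. of_nat (k choose j) * x ^ j) = (x + 1) ^ k" if "k \<le> n" for k
    proof -
      have "(\<Sum>j\<le>n. of_nat (k choose j) * x ^ j) = (\<Sum>j\<le>k. of_nat (k choose j) * x ^ j)"
        by (rule sum.mono_neutral_right) (use that in \<open>auto simp: binomial_eq_0\<close>)
      then show ?thesis using binomial_ring[of x 1 k] by simp
    qed
    have M1_row: "(\<Sum>j\<le>n. M1_b n t $$ (l, j) * x ^ j) = ((1 - t) * x) ^ l * (t * x + 1) ^ (n - l)"
      if l: "l \<le> n" for l
    proof -
      have "(\<Sum>j\<le>n. M1_b n t $$ (l, j) * x ^ j)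
          = (\<Sum>j=l..n. of_nat ((n - l) choose (j - l)) * t ^ (j - l) * (1 - t) ^ l * x ^ j)"
      proof (rule sum.mono_neutral_cong_right)
        fix j assume j: "j \<in> {l..n}"
        then have "(n - l) choose (n - j) = (n - l) choose (j - l)"
          by (subst binomial_symmetric) auto
        then show "M1_b n t $$ (l, j) * x ^ j
            = of_nat ((n - l) choose (j - l)) * t ^ (j - l) * (1 - t) ^ l * x ^ j"
          using j by (simp add: M1_b_def)
      qed (use l in \<open>auto simp: M1_b_def\<close>)
      also have "\<dots> = (\<Sum>k\<le>n - l. of_nat ((n - l) choose k) * t ^ k * (1 - t) ^ l * x ^ (k + l))"
        by (rule sum.reindex_bij_witness[of _ "\<lambda>k. k + l" "\<lambda>j. j - l"]) (use l in auto)
      also have "\<dots> = ((1 - t) * x) ^ l * (\<Sum>k\<le>n - l. of_nat ((n - l) choose k) * (t * x) ^ k)"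
        by (simp add: sum_distrib_left power_add power_mult_distrib mult_ac)
      finally show ?thesis using binomial_ring[of "t * x" 1 "n - l"] by simp
    qed
    have "(\<Sum>j\<le>n. ?l j * x ^ j)
        = (\<Sum>k=i..n. bernstein (n - i) (k - i) t * (\<Sum>j\<le>n. of_nat (k choose j) * x ^ j))"
      unfolding sum_distrib_right sum_distrib_left by (subst sum.swap) (simp add: mult.assoc)
    also have "\<dots> = (\<Sum>k=i..n. bernstein (n - i) (k - i) t * (x + 1) ^ k)"
      by (rule sum.cong) (simp_all add: row)
    also have "\<dots> = (\<Sum>k\<le>n - i. bernstein (n - i) k t * (x + 1) ^ (k + i))"
      by (rule sum.reindex_bij_witness[of _ "\<lambda>k. k + i" "\<lambda>k. k - i"]) (use i in auto)
    also have "\<dots> = (x + 1) ^ i * (\<Sum>k\<le>n - i. of_nat ((n - i) choose k) * (t * (x + 1)) ^ k * (1 - t) ^ (n - i - k))"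
      by (simp add: bernstein_def sum_distrib_left power_add power_mult_distrib mult_ac)
    also have "\<dots> = (x + 1) ^ i * (t * (x + 1) + (1 - t)) ^ (n - i)"
      by (simp only: binomial_ring)
    also have "t * (x + 1) + (1 - t) = t * x + 1" by (simp add: algebra_simps)
    \<comment> \<open>Splitting \<open>x + 1\<close> this way lets its expansion share the base
      \<open>t * x + 1\<close> with the other factor, so that the exponents add up to
      \<open>n - l\<close>.\<close>
    also have "(x + 1) ^ i = ((1 - t) * x + (t * x + 1)) ^ i" by (simp add: algebra_simps)
    also have "\<dots> * (t * x + 1) ^ (n - i)
        = (\<Sum>l\<le>i. of_nat (i choose l) * (((1 - t) * x) ^ l * ((t * x + 1) ^ (i - l) * (t * x + 1) ^ (n - i))))"
      by (simp only: binomial_ring[of "(1 - t) * x" "t * x + 1" i] sum_distrib_right mult.assoc)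
    also have "\<dots> = (\<Sum>l\<le>i. of_nat (i choose l) * (((1 - t) * x) ^ l * (t * x + 1) ^ (n - l)))"
      using i by (intro sum.cong refl) (simp add: power_add[symmetric])
    also have "\<dots> = (\<Sum>l\<le>n. of_nat (i choose l) * (((1 - t) * x) ^ l * (t * x + 1) ^ (n - l)))"
      by (rule sum.mono_neutral_left) (use i in \<open>auto simp: binomial_eq_0\<close>)
    also have "\<dots> = (\<Sum>l\<le>n. of_nat (i choose l) * (\<Sum>j\<le>n. M1_b n t $$ (l, j) * x ^ j))"
      by (rule sum.cong) (simp_all add: M1_row)
    also have "\<dots> = (\<Sum>j\<le>n. ?r j * x ^ j)"
      unfolding sum_distrib_right sum_distrib_left by (subst sum.swap) (simp add: mult.assoc)
    finally show ?thesis .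
  qed
  then have "\<forall>x. (\<Sum>j\<le>n. ?l j * x ^ j) = (\<Sum>j\<le>n. ?r j * x ^ j)" by (rule allI)
  then have eq: "?l j = ?r j" using j unfolding polyfun_eq_coeffs by simp
  have ij: "i < n + 1" "j < n + 1" using i j by auto
  have "(casteljau_R n t * binomial_mat n) $$ (i, j) = ?l j"
    unfolding index_mult_mat_sum[OF casteljau_carrier(2) binomial_mat_carrier ij]
    by (rule sum.mono_neutral_cong_right) (use ij in \<open>auto simp: casteljau_R_def binomial_mat_def\<close>)
  also have "\<dots> = (binomial_mat n * M1_b n t) $$ (i, j)"
    unfolding eq index_mult_mat_sum[OF binomial_mat_carrier M1_b_carrier ij]
    by (rule sum.cong) (use ij in \<open>auto simp: binomial_mat_def\<close>)
  finally show "(casteljau_R n t * binomial_mat n) $$ (i, j) = (binomial_mat n * M1_b n t) $$ (i, j)" .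
qed (simp_all add: casteljau_R_def binomial_mat_def M1_b_def)

text \<open>The similarity is given by \<open>Pi * ?K\<close>: the inner product
  \<open>?P * Pi\<close> cancels, and the similarities of the de Casteljau matrices by
  \<open>?K\<close> remain.\<close>

lemma attractor_a:
  assumes n: "1 \<le> n" and p: "p $ (n - 1) \<noteq> p $ n"
    and t: "cmod t < 1" "cmod (1 - t) < 1"
  shows "(\<exists>!A. is_attractor (complex_vec_metric n)
             (affine_map_a n (M0_a n t p)) (affine_map_a n (M1_a n t p)) A) \<and>
     (\<forall>A. is_attractor (complex_vec_metric n)
             (affine_map_a n (M0_a n t p)) (affine_map_a n (M1_a n t p)) A \<longrightarrow>
           connectedin (mtopology_of (complex_vec_metric n)) A)"
proof -
  let ?P = "P_mat n p" and ?K = "binomial_mat n"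
  obtain Pi where inv: "mat_inverse ?P = Some Pi" and Pi: "Pi \<in> carrier_mat (n + 1) (n + 1)"
    and PPi: "?P * Pi = 1\<^sub>m (n + 1)" and PiP: "Pi * ?P = 1\<^sub>m (n + 1)"
    using P_mat_inverse[OF n p] by metis
  obtain Ki where Ki: "Ki \<in> carrier_mat (n + 1) (n + 1)"
    and KKi: "?K * Ki = 1\<^sub>m (n + 1)" and KiK: "Ki * ?K = 1\<^sub>m (n + 1)"
    using binomial_mat_inverse by metis
  note carr = Pi Ki P_mat_carrier[of n p] binomial_mat_carrier[of n]
  note mult = mult_carrier_mat[of _ "n + 1" "n + 1" _ "n + 1"]
  note assoc = assoc_mult_mat[of _ "n + 1" "n + 1" _ "n + 1" _ "n + 1"]
  have cancel: "A * (B * D) = D" if "A * B = 1\<^sub>m (n + 1)" "A \<in> carrier_mat (n + 1) (n + 1)"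
    "B \<in> carrier_mat (n + 1) (n + 1)" "D \<in> carrier_mat (n + 1) (n + 1)" for A B D :: "complex Matrix.mat"
    using assoc[OF that(2-4)] that(1) left_mult_one_mat[OF that(4)] by simp
  have sim: "Pi * C * ?P * (Pi * ?K) = Pi * ?K * T"
    if "C * ?K = ?K * T" and C: "C \<in> carrier_mat (n + 1) (n + 1)" and T: "T \<in> carrier_mat (n + 1) (n + 1)" for C T
  proof -
    have "Pi * C * ?P * (Pi * ?K) = Pi * C * (?P * (Pi * ?K))"
      by (intro assoc mult carr C)
    also have "?P * (Pi * ?K) = ?K" by (intro cancel PPi carr)
    also have "Pi * C * ?K = Pi * (C * ?K)" by (intro assoc carr C)
    also have "\<dots> = Pi * ?K * T" unfolding that(1) by (intro assoc[symmetric] carr T)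
    finally show ?thesis .
  qed
  have inverse: "(A * B) * (D * E) = 1\<^sub>m (n + 1)"
    if "A * E = 1\<^sub>m (n + 1)" "B * D = 1\<^sub>m (n + 1)" "A \<in> carrier_mat (n + 1) (n + 1)"
      "B \<in> carrier_mat (n + 1) (n + 1)" "D \<in> carrier_mat (n + 1) (n + 1)" "E \<in> carrier_mat (n + 1) (n + 1)"
    for A B D E :: "complex Matrix.mat"
    using assoc[OF that(3,4) mult[OF that(5,6)]] cancel[OF that(2,4,5,6)] that(1) by simp
  \<comment> \<open>Column 0 of \<open>?K\<close> and column \<open>n\<close> of \<open>?P\<close>
    both consist of ones, so column 0 of \<open>Pi * ?K\<close> is the last column of
    \<open>Pi * ?P\<close>, a unit vector.\<close>
  have Q0: "(Pi * ?K) $$ (i, 0) = (if i = n then 1 else 0)" if "i \<le> n" for i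
  proof -
    have i: "i < n + 1" and n': "n < n + 1" "0 < n + 1" using that by auto
    have "(Pi * ?K) $$ (i, 0) = (\<Sum>k<n + 1. Pi $$ (i, k) * ?P $$ (k, n))"
      unfolding index_mult_mat_sum[OF Pi binomial_mat_carrier i n'(2)]
      by (rule sum.cong) (use n in \<open>auto simp: binomial_mat_def P_mat_def\<close>)
    also have "\<dots> = (Pi * ?P) $$ (i, n)"
      by (rule index_mult_mat_sum[OF Pi P_mat_carrier i n'(1), symmetric])
    finally show ?thesis unfolding PiP using i by simp
  qed
  have M: "M0_a n t p = Pi * casteljau_L n t * ?P" "M1_a n t p = Pi * casteljau_R n t * ?P"
    by (simp_all add: M0_a_def M1_a_def inv)
  show ?thesis
  proof (rule attractor_a_if_similar[OF t, of _ _ _ "Pi * ?K" "Ki * ?P"])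
    show "M0_a n t p \<in> carrier_mat (n + 1) (n + 1)" "M1_a n t p \<in> carrier_mat (n + 1) (n + 1)"
      unfolding M by (intro mult carr casteljau_carrier)+
    show "M0_a n t p * (Pi * ?K) = Pi * ?K * M0_b n t" "M1_a n t p * (Pi * ?K) = Pi * ?K * M1_b n t"
      unfolding M by (intro sim casteljau_L_similar casteljau_R_similar casteljau_carrier M0_b_carrier M1_b_carrier)+
    show "Pi * ?K * (Ki * ?P) = 1\<^sub>m (n + 1)" "Ki * ?P * (Pi * ?K) = 1\<^sub>m (n + 1)"
      by (intro inverse PiP KKi KiK PPi carr)+
    show "Pi * ?K \<in> carrier_mat (n + 1) (n + 1)" "Ki * ?P \<in> carrier_mat (n + 1) (n + 1)"
      by (intro mult carr)+
  qed (use block_form_a[OF n p] Q0 in auto)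
qed

theorem theorem3p2:
  fixes n :: nat and t :: complex
  assumes "n \<ge> 1" and "cmod t < 1" and "cmod (1 - t) < 1"
  shows
    "(\<forall>p \<in> carrier_vec (n + 1). p $ (n - 1) \<noteq> p $ n \<longrightarrow>
        (\<exists>!A. is_attractor (complex_vec_metric n)
                (affine_map_a n (M0_a n t p)) (affine_map_a n (M1_a n t p)) A) \<and>
        (\<forall>A. is_attractor (complex_vec_metric n)
                (affine_map_a n (M0_a n t p)) (affine_map_a n (M1_a n t p)) A \<longrightarrow>
              connectedin (mtopology_of (complex_vec_metric n)) A))
     \<and>
     (\<exists>!A. is_attractor (complex_vec_metric n)
             (affine_map_b n (M0_b n t)) (affine_map_b n (M1_b n t)) A) \<and>
     (\<forall>A. is_attractor (complex_vec_metric n)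
             (affine_map_b n (M0_b n t)) (affine_map_b n (M1_b n t)) A \<longrightarrow>
           connectedin (mtopology_of (complex_vec_metric n)) A)"
  by (rule conjI[OF _ attractor_b[OF assms(2,3)]], intro ballI impI attractor_a[OF assms(1) _ assms(2,3)])

end
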